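(* Let $(\mathsf{X},\mathcal{A},\pi)$ be a probability space, let $(\mathsf{Y},\mathcal{B})$, $(\mathsf{Z},\mathcal{C})$ be measurable spaces, and let $\tilde\pi$ be a probability measure on $\mathcal{B}\times\mathcal{C}$ with $\tilde\pi(\mathrm{d}(y,z))=\varpi_z(\mathrm{d}y)\,\varpi(\mathrm{d}z)$, where $\varpi$ is the marginal of $\tilde\pi$ on $\mathsf{Z}$. Let $S$ be a Markov transition kernel on $\mathsf{X}$ reversible with respect to $\pi$. Assume: (1) as an operator on $L_0^2(\pi)$, $S=P^*QP$, where $P:L_0^2(\pi)\to L_0^2(\tilde\pi)$ is a linear transformation and $Q$ is (the operator on $L_0^2(\tilde\pi)$ of) a Markov transition kernel on $\mathsf{Y}\times\mathsf{Z}$ reversible with respect to $\tilde\pi$; (2) $\|Pf\|_{\tilde\pi}\le\|f\|_\pi$ for all $f\in L_0^2(\pi)$; (3) $\{Q_z\}_{z\in\mathsf{Z}}$ are Markov transition kernels on $\mathsf{Y}$ such that $Q_z$ is reversible with respect to $\varpi_z$ for $\varpi$-a.e. $z$, and $(y,z)\mapsto Q_z(y,\mathsf{B})$ is measurable for each $\mathsf{B}\in\mathcal{B}$; (4) there is a constant $c_0\in(0,1]$ such that, for $\tilde\pi$-a.e. $(y,z)\in\mathsf{Y}\times\mathsf{Z}$ and every $\mathsf{B}\in\mathcal{B}$, $Q((y,z),(\mathsf{B}\setminus\{y\})\times\{z\})\ge c_0\,Q_z(y,\mathsf{B}\setminus\{y\})$. Suppose that there is a constant $\kappa_\dagger\in[0,1]$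 such that $\mathrm{Gap}(Q_z)\ge\kappa_\dagger$ for $\varpi$-a.e. $z\in\mathsf{Z}$. Then, for every $f\in L_0^2(\pi)$, $$\mathcal{E}_S(f)\ \ge\ c_0\,\mathcal{E}_{P^*\hat QP}(f)\ \ge\ c_0\,\kappa_\dagger\,\mathcal{E}_{P^*E^*EP}(f).$$
   Context: For a probability measure $\rho$, $L_0^2(\rho)$ is the Hilbert space of real square-integrable functions with $\rho$-mean zero, with inner product $\langle\cdot,\cdot\rangle_\rho$ and norm $\|\cdot\|_\rho$. A Markov transition kernel $K$ with $\rho K=\rho$ acts on $L_0^2(\rho)$ by $Kf(w)=\int K(w,\mathrm{d}w')f(w')$; it is reversible iff this operator is self-adjoint. For self-adjoint $J$ on $L_0^2(\rho)$ with norm at most $1$: $\mathcal{E}_J(f)=\|f\|_\rho^2-\langle f,Jf\rangle_\rho$ and $\mathrm{Gap}(J)=\inf_{f\in L_0^2(\rho)\setminus\{0\}}\mathcal{E}_J(f)/\|f\|_\rho^2$; thus $\mathrm{Gap}(J)\ge\kappa$ means $\mathcal{E}_J(f)\ge\kappa\|f\|_\rho^2$ for all $f\in L_0^2(\rho)$. The gap of $Q_z$ is computed in $L_0^2(\varpi_z)$. $P^*$ is the Hilbert-space adjoint of $P$. $\hat Q$ is the Markov transition kernel on $\mathsf{Y}\times\mathsf{Z}$ given by $\hat Q((y,z),\mathrm{d}(y',z'))=Q_z(y,\mathrm{d}y')\,\delta_z(\mathrm{d}z')$, which is reversible with respect to $\tilde\pi$. $E:L_0^2(\tilde\pi)\to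 L_0^2(\varpi)$ is $Eh(z)=\int_{\mathsf{Y}}h(y,z)\,\varpi_z(\mathrm{d}y)$, with adjoint $E^*g(y,z)=g(z)$. Singletons of $\mathsf{Y}$ and $\mathsf{Z}$ are understood to be measurable, so that (4) makes sense. *)

theory Defs
  imports "HOL-Probability.Probability"
begin

text \<open>
  Elements of \<open>L\<^sub>0\<^sup>2\<close> are represented by functions rather than by classes modulo almost-everywhere
  equality; accordingly, equality of elements is almost-everywhere equality throughout.
\<close>

definition L2_0 :: "'a measure \<Rightarrow> ('a \<Rightarrow> real) set" where
  "L2_0 M = {f \<in> borel_measurable M. integrable M (\<lambda>x. (f x)\<^sup>2) \<and> integral\<^sup>L M f = 0}"

definition L2_inner :: "'a measure \<Rightarrow> ('a \<Rightarrow> real) \<Rightarrow> ('a \<Rightarrow> real) \<Rightarrow> real" where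
  "L2_inner M f g = (\<integral>x. f x * g x \<partial>M)"

definition L2_norm :: "'a measure \<Rightarrow> ('a \<Rightarrow> real) \<Rightarrow> real" where
  "L2_norm M f = sqrt (L2_inner M f f)"

definition L2_0_linear ::
    "'a measure \<Rightarrow> 'b measure \<Rightarrow> (('a \<Rightarrow> real) \<Rightarrow> 'b \<Rightarrow> real) \<Rightarrow> bool" where
  "L2_0_linear M N T \<longleftrightarrow>
     (\<forall>f\<in>L2_0 M. T f \<in> L2_0 N) \<and>
     (\<forall>f\<in>L2_0 M. \<forall>g\<in>L2_0 M. (AE x in M. f x = g x) \<longrightarrow> (AE w in N. T f w = T g w)) \<and>
     (\<forall>f\<in>L2_0 M. \<forall>g\<in>L2_0 M. AE w in N. T (\<lambda>x. f x + g x) w = T f w + T g w) \<and>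
     (\<forall>c. \<forall>f\<in>L2_0 M. AE w in N. T (\<lambda>x. c * f x) w = c * T f w)"

text \<open>
  As with \<^const>\<open>adjoint\<close>, the adjoint is selected by its characteristic property. For a linear
  operator that is bounded it exists by the Riesz representation theorem, and its values are
  determined up to almost-everywhere equality.
\<close>

definition L2_0_adjoint ::
    "'a measure \<Rightarrow> 'b measure \<Rightarrow> (('a \<Rightarrow> real) \<Rightarrow> 'b \<Rightarrow> real) \<Rightarrow> ('b \<Rightarrow> real) \<Rightarrow> 'a \<Rightarrow> real" where
  "L2_0_adjoint M N T = (SOME T'.
     (\<forall>h\<in>L2_0 N. T' h \<in> L2_0 M) \<and>
     (\<forall>f\<in>L2_0 M. \<forall>h\<in>L2_0 N. L2_inner N (T f) h = L2_inner M f (T' h)))"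

definition markov_kernel :: "'a measure \<Rightarrow> ('a \<Rightarrow> 'a measure) \<Rightarrow> bool" where
  "markov_kernel M K \<longleftrightarrow> K \<in> M \<rightarrow>\<^sub>M prob_algebra M"

definition kernel_op :: "('a \<Rightarrow> 'a measure) \<Rightarrow> ('a \<Rightarrow> real) \<Rightarrow> 'a \<Rightarrow> real" where
  "kernel_op K f w = (\<integral>w'. f w' \<partial>K w)"

definition reversible :: "'a measure \<Rightarrow> ('a \<Rightarrow> 'a measure) \<Rightarrow> bool" where
  "reversible M K \<longleftrightarrow> markov_kernel M K \<and> M \<bind> K = M \<and>
     (\<forall>f\<in>L2_0 M. \<forall>g\<in>L2_0 M. L2_inner M (kernel_op K f) g = L2_inner M f (kernel_op K g))"

definition dirichlet_form ::
    "'a measure \<Rightarrow> (('a \<Rightarrow> real) \<Rightarrow> 'a \<Rightarrow> real) \<Rightarrow> ('a \<Rightarrow> real) \<Rightarrow> real" where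
  "dirichlet_form M J f = (L2_norm M f)\<^sup>2 - L2_inner M f (J f)"

text \<open>
  The infimum is taken in the extended reals, so the gap is infinite when \<open>L\<^sub>0\<^sup>2\<close> is trivial and
  every lower bound on it then holds vacuously.
\<close>

definition spectral_gap :: "'a measure \<Rightarrow> (('a \<Rightarrow> real) \<Rightarrow> 'a \<Rightarrow> real) \<Rightarrow> ereal" where
  "spectral_gap M J =
     (INF f\<in>{f \<in> L2_0 M. \<not> (AE x in M. f x = 0)}. ereal (dirichlet_form M J f / (L2_norm M f)\<^sup>2))"

definition fibre_kernel ::
    "'z measure \<Rightarrow> ('z \<Rightarrow> 'y \<Rightarrow> 'y measure) \<Rightarrow> 'y \<times> 'z \<Rightarrow> ('y \<times> 'z) measure" where
  "fibre_kernel Z Qz = (\<lambda>(y, z). Qz z y \<Otimes>\<^sub>M return Z z)"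

definition fibre_mean :: "('z \<Rightarrow> 'y measure) \<Rightarrow> ('y \<times> 'z \<Rightarrow> real) \<Rightarrow> 'z \<Rightarrow> real" where
  "fibre_mean \<nu> h z = (\<integral>y. h (y, z) \<partial>\<nu> z)"

definition fibre_lift :: "('z \<Rightarrow> real) \<Rightarrow> 'y \<times> 'z \<Rightarrow> real" where
  "fibre_lift g = (\<lambda>(y, z). g z)"

end

theory Submission
  imports Defs
begin

text \<open>
  For a Markov kernel \<open>K\<close> with invariant probability measure \<open>M\<close>, twice the Dirichlet form at \<open>h\<close> is
  the energy \<open>\<integral>\<integral> (h w - h w')\<^sup>2 K(w, dw') M(dw)\<close>. The diagonal does not contribute, so the
  off-diagonal domination of \<open>Q\<close> over \<open>c0 Qz\<close> compares the energies of \<open>Q\<close> and of the fibre kernel.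
  The energy of a fibre kernel is the integral over \<open>z\<close> of the energies on the fibres, and \<open>E\<^sup>*E\<close> is
  itself the fibre kernel that resamples \<open>y\<close> from \<open>\<omega>z z\<close>, whose fibre energy is twice the variance:
  the spectral gaps compare these two fibre by fibre. Finally, passing from an operator \<open>J\<close> to
  \<open>P\<^sup>*JP\<close> adds \<open>\<parallel>f\<parallel>\<^sup>2 - \<parallel>Pf\<parallel>\<^sup>2 \<ge> 0\<close> to the Dirichlet form, which is harmless as \<open>c0, \<kappa> \<le> 1\<close>.
\<close>

section \<open>Inner product calculus on mean-zero square-integrable functions\<close>

lemma L2_0D:
  assumes "f \<in> L2_0 M"
  shows "f \<in> borel_measurable M" "integrable M (\<lambda>x. (f x)\<^sup>2)" "integral\<^sup>L M f = 0"
  using assms by (auto simp: L2_0_def)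

lemma integrable_mult_of_squares:
  fixes f g :: "'a \<Rightarrow> real"
  assumes [measurable]: "f \<in> borel_measurable M" "g \<in> borel_measurable M"
    and "integrable M (\<lambda>x. (f x)\<^sup>2)" "integrable M (\<lambda>x. (g x)\<^sup>2)"
  shows "integrable M (\<lambda>x. f x * g x)"
proof (rule Bochner_Integration.integrable_bound)
  show "integrable M (\<lambda>x. (f x)\<^sup>2 + (g x)\<^sup>2)" using assms by simp
  have "norm (a * b) \<le> norm (a\<^sup>2 + b\<^sup>2)" for a b :: real
    using sum_squares_bound[of "\<bar>a\<bar>" "\<bar>b\<bar>"] mult_nonneg_nonneg[of "\<bar>a\<bar>" "\<bar>b\<bar>"]
    by (simp add: abs_mult del: mult_nonneg_nonneg)
  then show "AE x in M. norm (f x * g x) \<le> norm ((f x)\<^sup>2 + (g x)\<^sup>2)" by simp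
qed simp

lemma L2_0_integrable_mult:
  "f \<in> L2_0 M \<Longrightarrow> g \<in> L2_0 M \<Longrightarrow> integrable M (\<lambda>x. f x * g x)"
  by (intro integrable_mult_of_squares L2_0D)

lemma L2_inner_self: "L2_inner M f f = (\<integral>x. (f x)\<^sup>2 \<partial>M)"
  by (simp add: L2_inner_def power2_eq_square)

lemma L2_inner_nonneg: "0 \<le> L2_inner M f f"
  by (simp add: L2_inner_self)

lemma L2_inner_commute: "L2_inner M f g = L2_inner M g f"
  by (simp add: L2_inner_def mult.commute)

lemma L2_norm_square: "(L2_norm M f)\<^sup>2 = L2_inner M f f"
  by (simp add: L2_norm_def L2_inner_nonneg)

lemma L2_0_integrable:
  assumes "prob_space M" "f \<in> L2_0 M" shows "integrable M f"
proof -
  interpret prob_space M by fact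
  show ?thesis by (rule square_integrable_imp_integrable[OF L2_0D(1,2)[OF assms(2)]])
qed

lemma L2_0_lincomb:
  assumes "prob_space M" "f \<in> L2_0 M" "g \<in> L2_0 M"
  shows "(\<lambda>x. a * f x + b * g x) \<in> L2_0 M"
proof -
  have "(a * f x + b * g x)\<^sup>2 = a\<^sup>2 * (f x)\<^sup>2 + b\<^sup>2 * (g x)\<^sup>2 + 2 * a * b * (f x * g x)" for x
    by (simp add: power2_eq_square algebra_simps)
  then show ?thesis
    using L2_0D[OF assms(2)] L2_0D[OF assms(3)] L2_0_integrable[OF assms(1,2)]
      L2_0_integrable[OF assms(1,3)] L2_0_integrable_mult[OF assms(2,3)]
    by (auto simp: L2_0_def)
qed

lemma L2_0_scale: "prob_space M \<Longrightarrow> f \<in> L2_0 M \<Longrightarrow> (\<lambda>x. a * f x) \<in> L2_0 M"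
  using L2_0_lincomb[of M f f a 0] by simp

lemma L2_0_diff: "prob_space M \<Longrightarrow> f \<in> L2_0 M \<Longrightarrow> g \<in> L2_0 M \<Longrightarrow> (\<lambda>x. f x - g x) \<in> L2_0 M"
  using L2_0_lincomb[of M f g 1 "-1"] by simp

lemma L2_inner_lincomb:
  assumes "f \<in> L2_0 M" "g \<in> L2_0 M" "h \<in> L2_0 M"
  shows "L2_inner M (\<lambda>x. a * f x + b * g x) h = a * L2_inner M f h + b * L2_inner M g h"
  using L2_0_integrable_mult[OF assms(1,3)] L2_0_integrable_mult[OF assms(2,3)]
  by (simp add: L2_inner_def distrib_right mult.assoc)

lemma L2_inner_square_lincomb:
  assumes "f \<in> L2_0 M" "g \<in> L2_0 M"
  shows "L2_inner M (\<lambda>x. a * f x + b * g x) (\<lambda>x. a * f x + b * g x) =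
    a\<^sup>2 * L2_inner M f f + 2 * a * b * L2_inner M f g + b\<^sup>2 * L2_inner M g g"
proof -
  have *: "(a * f x + b * g x) * (a * f x + b * g x) =
      a\<^sup>2 * (f x * f x) + 2 * a * b * (f x * g x) + b\<^sup>2 * (g x * g x)" for x
    by (simp add: power2_eq_square algebra_simps)
  show ?thesis
    using L2_0_integrable_mult[OF assms(1,1)] L2_0_integrable_mult[OF assms(2,2)]
      L2_0_integrable_mult[OF assms]
    unfolding L2_inner_def * by simp
qed

text \<open>A parabola is tested at its vertex; if \<open>b = 0\<close>, an affine function bounded
  below has slope zero. This serves both Cauchy-Schwarz and the first-variation estimate in the
  Riesz representation.\<close>

lemma quadratic_nonneg_discriminant:
  fixes a b c :: real
  assumes "\<And>t. 0 \<le> c + t * a + t\<^sup>2 * b" "0 \<le> b"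
  shows "a\<^sup>2 \<le> 4 * b * c"
proof (cases "b = 0")
  case True
  have "a = 0"
  proof (rule ccontr)
    assume "a \<noteq> 0"
    \<comment> \<open>At this \<open>t\<close> the affine function \<open>c + t * a\<close> takes
      the value -1.\<close>
    with assms(1)[of "- (c + 1) / a"] True show False by simp
  qed
  then show ?thesis using True by simp
next
  case False
  \<comment> \<open>The vertex is \<open>t = - a / (2 * b)\<close>; the factor \<open>4 * b\<close>
    clears denominators.\<close>
  have "0 \<le> 4 * b * (c + (- a / (2 * b)) * a + (- a / (2 * b))\<^sup>2 * b)"
    by (intro mult_nonneg_nonneg assms) (use assms in simp)
  also have "\<dots> = 4 * b * c - a\<^sup>2"
    using False by (simp add: power2_eq_square field_simps)
  finally show ?thesis by simp
qed

lemma tendsto_zero_square_le: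
  fixes u v :: "nat \<Rightarrow> real"
  assumes "\<And>n. (u n)\<^sup>2 \<le> v n" "v \<longlonglongrightarrow> 0"
  shows "u \<longlonglongrightarrow> 0"
proof -
  have "(\<lambda>n. (u n)\<^sup>2) \<longlonglongrightarrow> 0"
    by (rule tendsto_sandwich[OF _ _ tendsto_const assms(2)]) (use assms(1) in auto)
  then show ?thesis by simp
qed

lemma L2_inner_Cauchy_Schwarz:
  assumes "f \<in> L2_0 M" "g \<in> L2_0 M"
  shows "(L2_inner M f g)\<^sup>2 \<le> L2_inner M f f * L2_inner M g g"
proof -
  have "(2 * L2_inner M f g)\<^sup>2 \<le> 4 * L2_inner M g g * L2_inner M f f"
  proof (rule quadratic_nonneg_discriminant[OF _ L2_inner_nonneg])
    fix t
    show "0 \<le> L2_inner M f f + t * (2 * L2_inner M f g) + t\<^sup>2 * L2_inner M g g"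
      using L2_inner_square_lincomb[OF assms, of 1 t]
        L2_inner_nonneg[of M "\<lambda>x. 1 * f x + t * g x"]
      by (simp add: algebra_simps)
  qed
  then show ?thesis by (simp add: power_mult_distrib mult.commute)
qed

text \<open>Jensen's inequality for the square, read off from nonnegativity of the variance. It
  passes from L2 to L1 distances and bounds a kernel operator pointwise.\<close>

lemma (in prob_space) square_integral_le:
  fixes f :: "'a \<Rightarrow> real"
  assumes "f \<in> borel_measurable M" "integrable M (\<lambda>x. (f x)\<^sup>2)"
  shows "(integral\<^sup>L M f)\<^sup>2 \<le> (\<integral>x. (f x)\<^sup>2 \<partial>M)"
proof -
  have "integrable M f" using assms by (rule square_integrable_imp_integrable)
  then have "variance f = (\<integral>x. (f x)\<^sup>2 \<partial>M) - (integral\<^sup>L M f)\<^sup>2"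
    using assms by (intro variance_eq) auto
  then show ?thesis using variance_positive[of f] by simp
qed

section \<open>Completeness, Riesz representation and adjoints\<close>

text \<open>The Riesz-Fischer argument: on a probability space an L2-Cauchy sequence is L1-Cauchy,
  so a subsequence converges almost everywhere, and Fatou's lemma upgrades this to L2 convergence.
  Convergence along a subsequence is enough for a minimizing sequence.\<close>

lemma L2_0_complete:
  fixes s :: "nat \<Rightarrow> 'a \<Rightarrow> real"
  assumes M: "prob_space M" and s: "\<And>n. s n \<in> L2_0 M"
    and Cau: "\<And>e. e > 0 \<Longrightarrow> \<exists>N. \<forall>i\<ge>N. \<forall>j\<ge>N. (\<integral>x. (s i x - s j x)\<^sup>2 \<partial>M) < e"
  obtains f r where "f \<in> L2_0 M" "strict_mono r" "(\<lambda>n. \<integral>x. (s (r n) x - f x)\<^sup>2 \<partial>M) \<longlonglongrightarrow> 0"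
proof -
  interpret prob_space M by fact
  have [measurable]: "s n \<in> borel_measurable M" for n using s L2_0D by blast
  have d: "(\<lambda>x. s i x - s j x) \<in> L2_0 M" for i j using L2_0_diff M s by blast
  have "\<exists>N. \<forall>i\<ge>N. \<forall>j\<ge>N. (\<integral>x. norm (s i x - s j x) \<partial>M) < e" if e: "e > 0" for e
  proof -
    obtain N where N: "\<And>i j. i \<ge> N \<Longrightarrow> j \<ge> N \<Longrightarrow> (\<integral>x. (s i x - s j x)\<^sup>2 \<partial>M) < e\<^sup>2"
      using Cau[of "e\<^sup>2"] e by (auto simp del: zero_less_power2)
    have "(\<integral>x. norm (s i x - s j x) \<partial>M) < e" if "i \<ge> N" "j \<ge> N" for i j
    proof (rule power2_less_imp_less)
      have "(\<integral>x. norm (s i x - s j x) \<partial>M)\<^sup>2 \<le> (\<integral>x. (norm (s i x - s j x))\<^sup>2 \<partial>M)"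
        using L2_0D(2)[OF d] by (intro square_integral_le) auto
      also have "\<dots> < e\<^sup>2" using N[OF that] by simp
      finally show "(\<integral>x. norm (s i x - s j x) \<partial>M)\<^sup>2 < e\<^sup>2" .
    qed (use e in simp)
    then show ?thesis by blast
  qed
  then obtain r where r: "strict_mono r" "AE x in M. Cauchy (\<lambda>i. s (r i) x)"
    using cauchy_L1_AE_cauchy_subseq[of M s] L2_0_integrable[OF M s] by blast
  \<comment> \<open>Where the subsequence diverges, \<open>lim\<close> is one fixed unspecified
    value, so \<open>f\<close> is measurable everywhere; its values there lie over a null
    set.\<close>
  define f where "f x = lim (\<lambda>i. s (r i) x)" for x
  have [measurable]: "f \<in> borel_measurable M"
    unfolding f_def by measurable
  have lim: "AE x in M. (\<lambda>i. s (r i) x) \<longlonglongrightarrow> f x"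
    using r(2) by eventually_elim (simp add: f_def Cauchy_convergent convergent_LIMSEQ_iff[symmetric])
  \<comment> \<open>Fatou's lemma in the second index: the squared distance from
    \<open>s (r n)\<close> to \<open>f\<close> is at most the liminf over \<open>k\<close> of the
    squared distances from \<open>s (r n)\<close> to \<open>s (r k)\<close>.\<close>
  have tail: "\<exists>N. \<forall>n\<ge>N. (\<integral>\<^sup>+x. ennreal ((s (r n) x - f x)\<^sup>2) \<partial>M) \<le> ennreal e" if e: "e > 0" for e
  proof -
    obtain N where N: "\<And>i j. i \<ge> N \<Longrightarrow> j \<ge> N \<Longrightarrow> (\<integral>x. (s i x - s j x)\<^sup>2 \<partial>M) < e"
      using Cau[OF e] by auto
    have "(\<integral>\<^sup>+x. ennreal ((s (r n) x - f x)\<^sup>2) \<partial>M) \<le> ennreal e" if n: "n \<ge> N" for n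
    proof -
      have "(\<integral>\<^sup>+x. ennreal ((s (r n) x - f x)\<^sup>2) \<partial>M) =
          (\<integral>\<^sup>+x. liminf (\<lambda>k. ennreal ((s (r n) x - s (r k) x)\<^sup>2)) \<partial>M)"
      proof (rule nn_integral_cong_AE)
        show "AE x in M. ennreal ((s (r n) x - f x)\<^sup>2) =
            liminf (\<lambda>k. ennreal ((s (r n) x - s (r k) x)\<^sup>2))"
          using lim
        proof eventually_elim
          case (elim x)
          have "(\<lambda>k. ennreal ((s (r n) x - s (r k) x)\<^sup>2)) \<longlonglongrightarrow> ennreal ((s (r n) x - f x)\<^sup>2)"
            by (intro tendsto_intros elim)
          then show ?case by (intro lim_imp_Liminf[symmetric] sequentially_bot)
        qed
      qed
      also have "\<dots> \<le> liminf (\<lambda>k. \<integral>\<^sup>+x. ennreal ((s (r n) x - s (r k) x)\<^sup>2) \<partial>M)"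
        by (intro nn_integral_liminf) measurable
      also have "\<dots> \<le> ennreal e"
      proof (rule Liminf_le)
        show "\<forall>\<^sub>F k in sequentially. (\<integral>\<^sup>+x. ennreal ((s (r n) x - s (r k) x)\<^sup>2) \<partial>M) \<le> ennreal e"
          using eventually_ge_at_top[of N]
        proof eventually_elim
          case (elim k)
          have "(\<integral>\<^sup>+x. ennreal ((s (r n) x - s (r k) x)\<^sup>2) \<partial>M) =
              ennreal (\<integral>x. (s (r n) x - s (r k) x)\<^sup>2 \<partial>M)"
            using L2_0D(2)[OF d] by (intro nn_integral_eq_integral) auto
          also have "\<dots> \<le> ennreal e"
            using N[of "r n" "r k"] seq_suble[OF r(1)] n elim
            by (intro ennreal_leI less_imp_le) (meson order_trans)
          finally show ?case .
        qed
      qed simp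
      finally show ?thesis .
    qed
    then show ?thesis by blast
  qed
  \<comment> \<open>A single index at finite distance from \<open>f\<close> makes \<open>f\<close>
    square-integrable; the bound below rests on \<open>(2 * a - b)\<^sup>2 \<ge> 0\<close>.\<close>
  obtain N0 where N0: "\<forall>n\<ge>N0. (\<integral>\<^sup>+x. ennreal ((s (r n) x - f x)\<^sup>2) \<partial>M) \<le> ennreal 1"
    using tail[of 1] by auto
  have f2: "integrable M (\<lambda>x. (f x)\<^sup>2)"
  proof (rule Bochner_Integration.integrable_bound)
    have "integrable M (\<lambda>x. (s (r N0) x - f x)\<^sup>2)"
      using N0 by (intro integrableI_bounded) (auto intro: le_less_trans[of _ 1])
    then show "integrable M (\<lambda>x. 2 * (s (r N0) x - f x)\<^sup>2 + 2 * (s (r N0) x)\<^sup>2)"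
      using L2_0D(2)[OF s] by simp
    have "b\<^sup>2 \<le> 2 * (a - b)\<^sup>2 + 2 * a\<^sup>2" for a b :: real
      using zero_le_power2[of "2 * a - b"] by (simp add: power2_eq_square algebra_simps)
    then show "AE x in M. norm ((f x)\<^sup>2) \<le> norm (2 * (s (r N0) x - f x)\<^sup>2 + 2 * (s (r N0) x)\<^sup>2)"
      by simp
  qed simp
  have int_f: "integrable M f" using f2 by (rule square_integrable_imp_integrable[rotated]) simp
  have int_d: "integrable M (\<lambda>x. (s (r n) x - f x)\<^sup>2)" for n
  proof -
    have "(s (r n) x - f x)\<^sup>2 = (s (r n) x)\<^sup>2 + (f x)\<^sup>2 - 2 * (s (r n) x * f x)" for x
      by (simp add: power2_eq_square algebra_simps)
    then show ?thesis
      using integrable_mult_of_squares[of "s (r n)" M f] f2 L2_0D(2)[OF s] by simp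
  qed
  have conv: "(\<lambda>n. \<integral>x. (s (r n) x - f x)\<^sup>2 \<partial>M) \<longlonglongrightarrow> 0"
  proof (rule LIMSEQ_I)
    fix e :: real assume e: "e > 0"
    obtain N where N: "\<And>n. n \<ge> N \<Longrightarrow> (\<integral>\<^sup>+x. ennreal ((s (r n) x - f x)\<^sup>2) \<partial>M) \<le> ennreal (e/2)"
      using tail[of "e/2"] e by auto
    have "norm ((\<integral>x. (s (r n) x - f x)\<^sup>2 \<partial>M) - 0) < e" if "n \<ge> N" for n
      using N[OF that] e nn_integral_eq_integral[OF int_d, of n] by simp
    then show "\<exists>N. \<forall>n\<ge>N. norm ((\<integral>x. (s (r n) x - f x)\<^sup>2 \<partial>M) - 0) < e" by blast
  qed
  \<comment> \<open>The mean survives the limit: each \<open>s (r n)\<close> has mean zero, so by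
    Jensen the squared mean of \<open>f\<close> is bounded by a squared distance that tends to
    0.\<close>
  have "(integral\<^sup>L M f)\<^sup>2 \<le> (\<integral>x. (s (r n) x - f x)\<^sup>2 \<partial>M)" for n
    using square_integral_le[of "\<lambda>x. s (r n) x - f x"] int_d int_f L2_0_integrable[OF M s]
      L2_0D(3)[OF s] by simp
  then have "(integral\<^sup>L M f)\<^sup>2 \<le> 0"
    using LIMSEQ_le_const[OF conv] by blast
  then have "f \<in> L2_0 M" using f2 by (simp add: L2_0_def)
  then show ?thesis using that r(1) conv by blast
qed

text \<open>The representing function is the limit of a minimizing sequence of
  \<open>f \<mapsto> \<parallel>f\<parallel>\<^sup>2 / 2 - \<phi> f\<close>.\<close>

lemma L2_0_Riesz:
  fixes \<phi> :: "('a \<Rightarrow> real) \<Rightarrow> real"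
  assumes M: "prob_space M"
    and lin: "\<And>f g a b. f \<in> L2_0 M \<Longrightarrow> g \<in> L2_0 M \<Longrightarrow>
      \<phi> (\<lambda>x. a * f x + b * g x) = a * \<phi> f + b * \<phi> g"
    and bdd: "\<And>f. f \<in> L2_0 M \<Longrightarrow> 2 * \<phi> f \<le> L2_inner M f f + C"
  obtains k where "k \<in> L2_0 M" "\<And>f. f \<in> L2_0 M \<Longrightarrow> \<phi> f = L2_inner M f k"
proof -
  define J where "J f = L2_inner M f f / 2 - \<phi> f" for f
  define m where "m = (INF f\<in>L2_0 M. J f)"
  \<comment> \<open>The hypothesis \<open>bdd\<close> is boundedness of the functional in a form
    tailored to this step: it says exactly that \<open>J\<close> is at least
    \<open>- C / 2\<close>.\<close>
  have bb: "bdd_below (J ` L2_0 M)"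
    using bdd by (intro bdd_belowI2[of _ "- C / 2"]) (force simp: J_def)
  have z: "(\<lambda>x. 0) \<in> L2_0 M" by (simp add: L2_0_def)
  have m_le: "m \<le> J f" if "f \<in> L2_0 M" for f
    unfolding m_def using bb that by (rule cINF_lower)
  have "\<exists>f\<in>L2_0 M. J f < m + 1 / real (Suc n)" for n
    using cINF_less_iff[OF _ bb, of "m + 1 / real (Suc n)"] z unfolding m_def by auto
  then obtain s where s: "\<And>n. s n \<in> L2_0 M" "\<And>n. J (s n) < m + 1 / real (Suc n)" by metis
  define \<epsilon> where "\<epsilon> n = J (s n) - m" for n
  have \<epsilon>_le: "\<epsilon> n \<le> 1 / real (Suc n)" for n using s(2)[of n] by (simp add: \<epsilon>_def)
  have \<epsilon>_nonneg: "0 \<le> \<epsilon> n" for n using m_le[OF s(1)] by (simp add: \<epsilon>_def)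
  have \<epsilon>0: "\<epsilon> \<longlonglongrightarrow> 0"
    by (rule tendsto_sandwich[OF _ _ tendsto_const LIMSEQ_Suc[OF lim_1_over_n]])
      (use \<epsilon>_le \<epsilon>_nonneg in auto)
  have J_lincomb: "J (\<lambda>x. a * f x + b * g x) = a\<^sup>2 * L2_inner M f f / 2 + a * b * L2_inner M f g
      + b\<^sup>2 * L2_inner M g g / 2 - a * \<phi> f - b * \<phi> g" if "f \<in> L2_0 M" "g \<in> L2_0 M" for f g a b
    unfolding J_def L2_inner_square_lincomb[OF that] lin[OF that] by (simp add: field_simps)
  \<comment> \<open>Parallelogram identity: at the midpoint \<open>J\<close> equals the average of
    \<open>J (s i)\<close> and \<open>J (s j)\<close> minus an eighth of the squared distance, and
    it is still at least \<open>m\<close>.\<close>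
  have par: "(\<integral>x. (s i x - s j x)\<^sup>2 \<partial>M) \<le> 4 * (\<epsilon> i + \<epsilon> j)" for i j
  proof -
    have "(\<integral>x. (s i x - s j x)\<^sup>2 \<partial>M) =
        L2_inner M (s i) (s i) - 2 * L2_inner M (s i) (s j) + L2_inner M (s j) (s j)"
      using L2_inner_square_lincomb[OF s(1)[of i] s(1)[of j], of 1 "-1"]
      by (simp add: L2_inner_self)
    moreover have "m \<le> J (\<lambda>x. (1/2) * s i x + (1/2) * s j x)"
      by (intro m_le L2_0_lincomb M s)
    ultimately show ?thesis
      unfolding J_lincomb[OF s(1) s(1)] \<epsilon>_def J_def by (simp add: power2_eq_square field_simps)
  qed
  have Cau: "\<exists>N. \<forall>i\<ge>N. \<forall>j\<ge>N. (\<integral>x. (s i x - s j x)\<^sup>2 \<partial>M) < e" if "e > 0" for e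
  proof -
    have "\<forall>\<^sub>F n in sequentially. \<epsilon> n < e / 8" using \<epsilon>0 that by (intro order_tendstoD) auto
    then obtain N where N: "\<And>n. n \<ge> N \<Longrightarrow> \<epsilon> n < e / 8" by (auto simp: eventually_sequentially)
    have "4 * (\<epsilon> i + \<epsilon> j) < e" if "i \<ge> N" "j \<ge> N" for i j
      using N[OF that(1)] N[OF that(2)] by simp
    then show ?thesis using par by (meson le_less_trans)
  qed
  obtain k r where k: "k \<in> L2_0 M" and r: "strict_mono r"
    and conv: "(\<lambda>n. \<integral>x. (s (r n) x - k x)\<^sup>2 \<partial>M) \<longlonglongrightarrow> 0"
    by (rule L2_0_complete[OF M s(1) Cau])
  have "\<phi> f = L2_inner M f k" if f: "f \<in> L2_0 M" for f
  proof -
    have a: "(\<lambda>n. L2_inner M (s (r n)) f - \<phi> f) \<longlonglongrightarrow> 0"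
    proof -
      \<comment> \<open>An approximate Euler-Lagrange equation: \<open>m \<le> J (s n + t f)\<close>
        for every \<open>t\<close> is a nonnegative quadratic in \<open>t\<close> with constant term
        \<open>\<epsilon> n\<close>, so its linear coefficient, the derivative of \<open>J\<close>
        at \<open>s n\<close> in direction \<open>f\<close>, is small.\<close>
      have "(L2_inner M (s n) f - \<phi> f)\<^sup>2 \<le> 4 * (L2_inner M f f / 2) * \<epsilon> n" for n
      proof (rule quadratic_nonneg_discriminant)
        fix t
        show "0 \<le> \<epsilon> n + t * (L2_inner M (s n) f - \<phi> f) + t\<^sup>2 * (L2_inner M f f / 2)"
          using m_le[OF L2_0_lincomb[OF M s(1) f, of 1 n t]]
          unfolding J_lincomb[OF s(1) f] \<epsilon>_def J_def by (simp add: algebra_simps)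
      qed (simp add: L2_inner_nonneg)
      note le = this
      have "(\<lambda>n. 4 * (L2_inner M f f / 2) * \<epsilon> (r n)) \<longlonglongrightarrow> 0"
        by (intro tendsto_mult_right_zero LIMSEQ_subseq_LIMSEQ[OF \<epsilon>0 r, unfolded o_def])
      with le show ?thesis by (rule tendsto_zero_square_le)
    qed
    have b: "(\<lambda>n. L2_inner M (s (r n)) f - L2_inner M k f) \<longlonglongrightarrow> 0"
    proof -
      have "(L2_inner M (s (r n)) f - L2_inner M k f)\<^sup>2 \<le>
          (\<integral>x. (s (r n) x - k x)\<^sup>2 \<partial>M) * L2_inner M f f" for n
        using L2_inner_lincomb[OF s(1)[of "r n"] k f, of 1 "-1"]
          L2_inner_Cauchy_Schwarz[OF L2_0_diff[OF M s(1)[of "r n"] k] f]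
        by (simp add: L2_inner_self)
      moreover have "(\<lambda>n. (\<integral>x. (s (r n) x - k x)\<^sup>2 \<partial>M) * L2_inner M f f) \<longlonglongrightarrow> 0"
        by (intro tendsto_mult_left_zero conv)
      ultimately show ?thesis by (rule tendsto_zero_square_le)
    qed
    have "(\<lambda>n. L2_inner M k f - \<phi> f) \<longlonglongrightarrow> 0"
      using tendsto_diff[OF a b] by simp
    then show ?thesis by (simp add: LIMSEQ_const_iff L2_inner_commute)
  qed
  with k that show ?thesis by blast
qed

lemma L2_inner_cong_AE:
  assumes "AE x in M. f x = f' x" "f \<in> L2_0 M" "f' \<in> L2_0 M" "h \<in> L2_0 M"
  shows "L2_inner M f h = L2_inner M f' h"
proof -
  note [measurable] = assms(2-4)[THEN L2_0D(1)]
  show ?thesis unfolding L2_inner_def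
    by (intro integral_cong_AE) (use assms(1) in auto)
qed

text \<open>\<open>L2_0_adjoint\<close> is a choice term, so some adjoint has to be exhibited before
  anything is known about it. For each \<open>h\<close>, the Riesz representation is applied to
  \<open>f \<mapsto> L2_inner N (T f) h\<close>, and the representing functions are collected by
  choice.\<close>

lemma L2_0_adjoint_spec:
  assumes M: "prob_space M" and N: "prob_space N" and T: "L2_0_linear M N T"
    and contr: "\<And>f. f \<in> L2_0 M \<Longrightarrow> L2_norm N (T f) \<le> L2_norm M f"
    and h: "h \<in> L2_0 N"
  shows "L2_0_adjoint M N T h \<in> L2_0 M"
    and "f \<in> L2_0 M \<Longrightarrow> L2_inner N (T f) h = L2_inner M f (L2_0_adjoint M N T h)"
proof -
  have T_in: "T f \<in> L2_0 N" if "f \<in> L2_0 M" for f using T that by (auto simp: L2_0_linear_def)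
  have T_lin: "AE w in N. T (\<lambda>x. a * f x + b * g x) w = a * T f w + b * T g w"
    if "f \<in> L2_0 M" "g \<in> L2_0 M" for f g a b
  proof -
    have "AE w in N. T (\<lambda>x. a * f x + b * g x) w = T (\<lambda>x. a * f x) w + T (\<lambda>x. b * g x) w"
      using T that L2_0_scale[OF M] by (simp add: L2_0_linear_def)
    moreover have "AE w in N. T (\<lambda>x. a * f x) w = a * T f w"
      "AE w in N. T (\<lambda>x. b * g x) w = b * T g w"
      using T that by (simp_all add: L2_0_linear_def)
    ultimately show ?thesis by eventually_elim simp
  qed
  have T_le: "L2_inner N (T f) (T f) \<le> L2_inner M f f" if "f \<in> L2_0 M" for f
    using contr[OF that] by (simp add: L2_norm_def)
  have "\<exists>k. k \<in> L2_0 M \<and> (\<forall>f\<in>L2_0 M. L2_inner N (T f) h = L2_inner M f k)" if h: "h \<in> L2_0 N" for h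
  proof -
    obtain k where "k \<in> L2_0 M" "\<And>f. f \<in> L2_0 M \<Longrightarrow> L2_inner N (T f) h = L2_inner M f k"
    proof (rule L2_0_Riesz[OF M, of "\<lambda>f. L2_inner N (T f) h" "L2_inner N h h"])
      fix f g :: "'a \<Rightarrow> real" and a b :: real assume fg: "f \<in> L2_0 M" "g \<in> L2_0 M"
      have "L2_inner N (T (\<lambda>x. a * f x + b * g x)) h = L2_inner N (\<lambda>w. a * T f w + b * T g w) h"
        using fg by (intro L2_inner_cong_AE T_lin T_in L2_0_lincomb M N h)
      then show "L2_inner N (T (\<lambda>x. a * f x + b * g x)) h =
          a * L2_inner N (T f) h + b * L2_inner N (T g) h"
        by (simp add: L2_inner_lincomb T_in fg h)
    next
      fix f assume f: "f \<in> L2_0 M"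
      \<comment> \<open>Expand \<open>0 \<le> \<parallel>T f - h\<parallel>\<^sup>2\<close> and use
        that \<open>T\<close> is a contraction.\<close>
      show "2 * L2_inner N (T f) h \<le> L2_inner M f f + L2_inner N h h"
        using L2_inner_nonneg[of N "\<lambda>w. 1 * T f w + (- 1) * h w"] T_le[OF f]
        unfolding L2_inner_square_lincomb[OF T_in[OF f] h] by simp
    qed blast
    then show ?thesis by blast
  qed
  then have "\<forall>h. \<exists>k. h \<in> L2_0 N \<longrightarrow>
      k \<in> L2_0 M \<and> (\<forall>f\<in>L2_0 M. L2_inner N (T f) h = L2_inner M f k)"
    by auto
  from choice[OF this] obtain T' where
    "\<forall>h. h \<in> L2_0 N \<longrightarrow> T' h \<in> L2_0 M \<and> (\<forall>f\<in>L2_0 M. L2_inner N (T f) h = L2_inner M f (T' h))" ..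
  note T' = this
  define adj where "adj U \<longleftrightarrow> (\<forall>h\<in>L2_0 N. U h \<in> L2_0 M) \<and>
      (\<forall>f\<in>L2_0 M. \<forall>h\<in>L2_0 N. L2_inner N (T f) h = L2_inner M f (U h))" for U
  have "adj T'" using T' by (simp add: adj_def)
  then have "adj (SOME U. adj U)" by (rule someI[of adj])
  moreover have "L2_0_adjoint M N T = (SOME U. adj U)"
    unfolding L2_0_adjoint_def adj_def ..
  ultimately have spec: "adj (L2_0_adjoint M N T)" by (simp only:)
  show "L2_0_adjoint M N T h \<in> L2_0 M"
    using spec h by (simp add: adj_def)
  show "L2_inner N (T f) h = L2_inner M f (L2_0_adjoint M N T h)" if "f \<in> L2_0 M"
    using spec h that by (simp add: adj_def)
qed

section \<open>Energy and Dirichlet form of a kernel with an invariant measure\<close>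

text \<open>With values in \<open>ennreal\<close>, energies can be compared pointwise and
  disintegrated over fibres without integrability conditions.\<close>

definition kernel_energy :: "'a measure \<Rightarrow> ('a \<Rightarrow> 'a measure) \<Rightarrow> ('a \<Rightarrow> real) \<Rightarrow> ennreal" where
  "kernel_energy M K h = (\<integral>\<^sup>+w. \<integral>\<^sup>+w'. ennreal ((h w - h w')\<^sup>2) \<partial>K w \<partial>M)"

text \<open>The energy identity rests on invariance: under \<open>M(dw) K(w, dw')\<close> both
  coordinates have distribution \<open>M\<close>.\<close>

locale invariant_kernel = prob_space M for M :: "'a measure" +
  fixes K :: "'a \<Rightarrow> 'a measure"
  assumes markov: "markov_kernel M K" and invariant: "M \<bind> K = M"
begin

lemma subprob_kernel: "K \<in> M \<rightarrow>\<^sub>M subprob_algebra M"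
  using markov by (auto simp: markov_kernel_def intro: measurable_prob_algebraD)

lemma kernel_prob_space: "w \<in> space M \<Longrightarrow> prob_space (K w)"
  and kernel_sets: "w \<in> space M \<Longrightarrow> sets (K w) = sets M"
  using measurable_space[of K M "prob_algebra M" w] markov
  by (auto simp: markov_kernel_def space_prob_algebra)

lemma kernel_borel_measurable:
  "w \<in> space M \<Longrightarrow> h \<in> borel_measurable M \<Longrightarrow> h \<in> borel_measurable (K w)"
  using measurable_cong_sets[OF kernel_sets refl, of w borel] by auto

lemma nn_integral_kernel:
  "f \<in> borel_measurable M \<Longrightarrow> (\<integral>\<^sup>+w. \<integral>\<^sup>+w'. f w' \<partial>K w \<partial>M) = (\<integral>\<^sup>+w. f w \<partial>M)"
  using nn_integral_bind[OF _ subprob_kernel, of f] by (simp add: invariant)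

lemma kernel_op_measurable:
  "h \<in> borel_measurable M \<Longrightarrow> kernel_op K h \<in> borel_measurable M"
  unfolding kernel_op_def
  by (rule measurable_compose[OF subprob_kernel integral_measurable_subprob_algebra])

text \<open>By invariance the inner integrals of \<open>\<bar>f\<bar>\<close> have the finite total
  \<open>\<integral>\<bar>f\<bar> dM\<close>, hence are finite almost everywhere.\<close>

lemma AE_integrable_kernel:
  fixes f :: "'a \<Rightarrow> real"
  assumes f: "integrable M f"
  shows "AE w in M. integrable (K w) f"
proof -
  have [measurable]: "f \<in> borel_measurable M" using f by auto
  have "(\<integral>\<^sup>+w. \<integral>\<^sup>+w'. ennreal (norm (f w')) \<partial>K w \<partial>M) \<noteq> \<infinity>"
    using f by (subst nn_integral_kernel) (auto simp: integrable_iff_bounded)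
  then have "AE w in M. (\<integral>\<^sup>+w'. ennreal (norm (f w')) \<partial>K w) \<noteq> \<infinity>"
    by (intro nn_integral_PInf_AE
        measurable_compose[OF subprob_kernel nn_integral_measurable_subprob_algebra]) auto
  moreover have "AE w in M. w \<in> space M" by simp
  ultimately show ?thesis
    by eventually_elim
      (auto simp: integrable_iff_bounded kernel_borel_measurable less_top[symmetric])
qed

lemma integrable_kernel_op_nonneg:
  fixes f :: "'a \<Rightarrow> real"
  assumes f: "integrable M f" and nonneg: "\<And>w. 0 \<le> f w"
  shows "integrable M (kernel_op K f) \<and> integral\<^sup>L M (kernel_op K f) = integral\<^sup>L M f"
proof -
  have [measurable]: "f \<in> borel_measurable M" using f by auto
  have "(\<integral>\<^sup>+w. ennreal (kernel_op K f w) \<partial>M) = (\<integral>\<^sup>+w. \<integral>\<^sup>+w'. ennreal (f w') \<partial>K w \<partial>M)"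
    using AE_integrable_kernel[OF f]
    by (intro nn_integral_cong_AE, eventually_elim)
      (simp add: kernel_op_def nn_integral_eq_integral nonneg)
  also have "\<dots> = ennreal (integral\<^sup>L M f)"
    using f nonneg by (subst nn_integral_kernel) (auto simp: nn_integral_eq_integral)
  finally show ?thesis
    using nonneg
    by (subst (asm) nn_integral_eq_integrable)
      (auto simp: kernel_op_measurable kernel_op_def intro!: integral_nonneg_AE)
qed

lemma integrable_kernel_op:
  fixes f :: "'a \<Rightarrow> real"
  assumes f: "integrable M f"
  shows "integrable M (kernel_op K f)" "integral\<^sup>L M (kernel_op K f) = integral\<^sup>L M f"
proof -
  define p n where "p w = max 0 (f w)" and "n w = max 0 (- f w)" for w
  have [measurable]: "f \<in> borel_measurable M" using f by auto
  have p: "integrable M p" and n: "integrable M n" using f by (auto simp: p_def[abs_def] n_def[abs_def])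
  have f_eq: "f w = p w - n w" for w by (simp add: p_def n_def)
  note P = integrable_kernel_op_nonneg[OF p] and N = integrable_kernel_op_nonneg[OF n]
  have nn: "0 \<le> p w" "0 \<le> n w" for w by (simp_all add: p_def n_def)
  \<comment> \<open>Where \<open>p\<close> or \<open>n\<close> fails to be
    \<open>K w\<close>-integrable, the integral of \<open>f\<close> defaults to 0 and the difference
    formula may fail; this happens on a null set.\<close>
  have eq: "AE w in M. kernel_op K f w = kernel_op K p w - kernel_op K n w"
    using AE_integrable_kernel[OF p] AE_integrable_kernel[OF n]
    by eventually_elim (simp add: kernel_op_def f_eq)
  have d: "integrable M (\<lambda>w. kernel_op K p w - kernel_op K n w)" using P N nn by simp
  have m [measurable]: "kernel_op K f \<in> borel_measurable M" by (rule kernel_op_measurable) simp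
  show "integrable M (kernel_op K f)"
    using integrable_cong_AE[OF m borel_measurable_integrable[OF d] eq] d by simp
  show "integral\<^sup>L M (kernel_op K f) = integral\<^sup>L M f"
    using integral_cong_AE[OF m borel_measurable_integrable[OF d] eq] P N nn p n
    by (simp add: f_eq[abs_def])
qed

text \<open>Jensen at almost every \<open>w\<close> gives
  \<open>(K h)\<^sup>2 \<le> K (h\<^sup>2)\<close>, and the right side is integrable by
  invariance.\<close>

lemma kernel_op_square_integrable:
  assumes [measurable]: "h \<in> borel_measurable M" and h2: "integrable M (\<lambda>w. (h w)\<^sup>2)"
  shows "integrable M (\<lambda>w. (kernel_op K h w)\<^sup>2)"
proof (rule Bochner_Integration.integrable_bound)
  show "integrable M (kernel_op K (\<lambda>w. (h w)\<^sup>2))" using h2 by (rule integrable_kernel_op)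
  have [measurable]: "kernel_op K h \<in> borel_measurable M" by (rule kernel_op_measurable) simp
  show "(\<lambda>w. (kernel_op K h w)\<^sup>2) \<in> borel_measurable M" by simp
  have "AE w in M. w \<in> space M" by simp
  with AE_integrable_kernel[OF h2]
  show "AE w in M. norm ((kernel_op K h w)\<^sup>2) \<le> norm (kernel_op K (\<lambda>w. (h w)\<^sup>2) w)"
  proof eventually_elim
    case (elim w)
    then have "(kernel_op K h w)\<^sup>2 \<le> kernel_op K (\<lambda>w. (h w)\<^sup>2) w"
      unfolding kernel_op_def
      by (intro prob_space.square_integral_le kernel_prob_space kernel_borel_measurable) auto
    then show ?case by simp
  qed
qed

lemma kernel_op_L2_0: "h \<in> L2_0 M \<Longrightarrow> kernel_op K h \<in> L2_0 M"
  using kernel_op_square_integrable[of h] integrable_kernel_op(2)[OF L2_0_integrable, of h]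
    prob_space_axioms
  by (auto simp: L2_0_def kernel_op_measurable)

lemma kernel_energy_integrand_measurable:
  assumes [measurable]: "h \<in> borel_measurable M"
  shows "(\<lambda>w. \<integral>\<^sup>+w'. ennreal ((h w - h w')\<^sup>2) \<partial>K w) \<in> borel_measurable M"
  by (rule nn_integral_measurable_subprob_algebra2[OF _ subprob_kernel]) measurable

lemma kernel_energy_eq_dirichlet_form:
  assumes h [measurable]: "h \<in> borel_measurable M" and h2: "integrable M (\<lambda>w. (h w)\<^sup>2)"
  shows "kernel_energy M K h = ennreal (2 * dirichlet_form M (kernel_op K) h)"
    and "0 \<le> dirichlet_form M (kernel_op K) h"
proof -
  \<comment> \<open>\<open>e w\<close> is the inner energy integral with the square expanded. By
    invariance its last term integrates to the same value as its first, whence the factor 2.\<close>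
  define e where "e w = (h w)\<^sup>2 - 2 * (h w * kernel_op K h w) + kernel_op K (\<lambda>w. (h w)\<^sup>2) w" for w
  have "AE w in M. w \<in> space M" by simp
  with AE_integrable_kernel[OF h2]
  have inner: "AE w in M. (\<integral>\<^sup>+w'. ennreal ((h w - h w')\<^sup>2) \<partial>K w) = ennreal (e w) \<and> 0 \<le> e w"
  proof eventually_elim
    case (elim w)
    interpret Kw: prob_space "K w" using elim by (intro kernel_prob_space)
    have hK: "integrable (K w) h"
      by (rule Kw.square_integrable_imp_integrable[OF kernel_borel_measurable[OF elim(2) h] elim(1)])
    have sq: "(h w - h w')\<^sup>2 = (h w)\<^sup>2 - 2 * h w * h w' + (h w')\<^sup>2" for w'
      by (simp add: power2_eq_square algebra_simps)
    have int: "integrable (K w) (\<lambda>w'. (h w - h w')\<^sup>2)"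
      unfolding sq using hK elim by simp
    have e: "(\<integral>w'. (h w - h w')\<^sup>2 \<partial>K w) = e w"
      unfolding sq using hK elim by (simp add: e_def kernel_op_def Kw.prob_space)
    have "0 \<le> e w" unfolding e[symmetric] by simp
    then show ?case using nn_integral_eq_integral[OF int] e by simp
  qed
  have K2: "integrable M (\<lambda>w. (kernel_op K h w)\<^sup>2)" using assms by (rule kernel_op_square_integrable)
  have hK: "integrable M (\<lambda>w. h w * kernel_op K h w)"
    using h2 K2 by (intro integrable_mult_of_squares kernel_op_measurable) auto
  have int_e: "integrable M e"
    unfolding e_def[abs_def] using h2 hK integrable_kernel_op(1)[OF h2] by simp
  have e_eq: "integral\<^sup>L M e = 2 * dirichlet_form M (kernel_op K) h"
    unfolding e_def[abs_def] using h2 hK integrable_kernel_op[OF h2]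
    by (simp add: dirichlet_form_def L2_norm_square L2_inner_self L2_inner_def[of M h "kernel_op K h"])
  have "kernel_energy M K h = (\<integral>\<^sup>+w. ennreal (e w) \<partial>M)"
    unfolding kernel_energy_def using inner by (intro nn_integral_cong_AE) (auto elim: eventually_mono)
  also have "\<dots> = ennreal (integral\<^sup>L M e)"
    using inner by (intro nn_integral_eq_integral int_e) (auto elim: eventually_mono)
  finally show "kernel_energy M K h = ennreal (2 * dirichlet_form M (kernel_op K) h)"
    by (simp add: e_eq)
  have "0 \<le> integral\<^sup>L M e" using inner by (intro integral_nonneg_AE) (auto elim: eventually_mono)
  then show "0 \<le> dirichlet_form M (kernel_op K) h" by (simp add: e_eq)
qed

end

section \<open>From energies to Dirichlet forms and spectral gaps\<close>

text \<open>The factor 2 cancels. Since \<open>ennreal\<close> truncates negative reals to 0,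
  nonnegativity of the forms is what allows the return to real numbers.\<close>

lemma kernel_energy_le_imp_dirichlet_form_le:
  assumes K: "invariant_kernel M K" and L: "invariant_kernel M L"
    and h: "h \<in> borel_measurable M" "integrable M (\<lambda>w. (h w)\<^sup>2)" and c: "0 \<le> c"
    and le: "ennreal c * kernel_energy M K h \<le> kernel_energy M L h"
  shows "c * dirichlet_form M (kernel_op K) h \<le> dirichlet_form M (kernel_op L) h"
proof -
  note eK = invariant_kernel.kernel_energy_eq_dirichlet_form[OF K h]
  note eL = invariant_kernel.kernel_energy_eq_dirichlet_form[OF L h]
  have "ennreal (c * (2 * dirichlet_form M (kernel_op K) h)) \<le>
      ennreal (2 * dirichlet_form M (kernel_op L) h)"
    using le c eK(2) unfolding eK(1) eL(1) by (simp only: ennreal_mult)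
  then show ?thesis
    using eL(2) by (subst (asm) ennreal_le_iff) auto
qed

lemma reversible_invariant_kernel:
  "prob_space M \<Longrightarrow> reversible M K \<Longrightarrow> invariant_kernel M K"
  by (simp add: reversible_def invariant_kernel_def invariant_kernel_axioms_def)

text \<open>This kernel resamples from \<open>M\<close> whatever its state. Its operator is the
  expectation, so its energy is twice the variance, the right side of a Poincare inequality.\<close>

lemma const_invariant_kernel:
  assumes "prob_space M" shows "invariant_kernel M (\<lambda>_. M)"
proof -
  interpret prob_space M by fact
  have "M \<bind> (\<lambda>_. M) = M"
    using assms by (intro measure_eqI)
      (auto simp: emeasure_bind_const_prob_space prob_space_imp_subprob_space not_empty sets_bind)
  then show ?thesis
    using assms by (simp add: invariant_kernel_def invariant_kernel_axioms_def markov_kernel_def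
        space_prob_algebra)
qed

lemma kernel_energy_shift: "kernel_energy M K (\<lambda>w. h w - c) = kernel_energy M K h"
  by (simp add: kernel_energy_def)

text \<open>On mean-zero functions the resampling operator vanishes, so its Dirichlet form is the
  squared norm, and the claim becomes the spectral gap inequality.\<close>

lemma spectral_gap_kernel_energy:
  assumes inv: "invariant_kernel M K" and gap: "ereal \<kappa> \<le> spectral_gap M (kernel_op K)"
    and \<kappa>: "0 \<le> \<kappa>" and h: "h \<in> borel_measurable M" and h2: "integrable M (\<lambda>w. (h w)\<^sup>2)"
  shows "ennreal \<kappa> * kernel_energy M (\<lambda>_. M) h \<le> kernel_energy M K h"
proof -
  interpret invariant_kernel M K by fact
  interpret const: invariant_kernel M "\<lambda>_. M" by (rule const_invariant_kernel) (rule prob_space_axioms)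
  \<comment> \<open>Energies do not change when a constant is added, so \<open>h\<close> may be centred.\<close>
  define g where "g w = h w - integral\<^sup>L M h" for w
  have int_h: "integrable M h" using h h2 by (rule square_integrable_imp_integrable)
  have "(g w)\<^sup>2 = (h w)\<^sup>2 - 2 * integral\<^sup>L M h * h w + (integral\<^sup>L M h)\<^sup>2" for w
    by (simp add: g_def power2_eq_square algebra_simps)
  then have g: "g \<in> L2_0 M"
    using int_h h2 h by (simp add: L2_0_def g_def[abs_def] prob_space)
  have const_eq: "dirichlet_form M (kernel_op (\<lambda>_. M)) g = L2_inner M g g"
    using L2_0D(3)[OF g] by (simp add: dirichlet_form_def L2_norm_square kernel_op_def L2_inner_def)
  have "\<kappa> * L2_inner M g g \<le> dirichlet_form M (kernel_op K) g"
  \<comment> \<open>The infimum defining the gap skips functions that vanish almost everywhere; for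
    these, nonnegativity of the form suffices.\<close>
  proof (cases "AE w in M. g w = 0")
    case True
    then have "L2_inner M g g = 0"
      unfolding L2_inner_def by (intro integral_eq_zero_AE) auto
    then show ?thesis using kernel_energy_eq_dirichlet_form(2)[OF L2_0D(1,2)[OF g]] by simp
  next
    case False
    have "L2_inner M g g \<noteq> 0"
      using False integral_nonneg_eq_0_iff_AE[OF L2_0D(2)[OF g]] by (simp add: L2_inner_self)
    then have pos: "0 < L2_inner M g g" using L2_inner_nonneg[of M g] by simp
    have "ereal \<kappa> \<le> ereal (dirichlet_form M (kernel_op K) g / (L2_norm M g)\<^sup>2)"
      using gap False g unfolding spectral_gap_def by (auto simp: le_INF_iff)
    then show ?thesis using pos by (simp add: L2_norm_square field_simps)
  qed
  then have "ennreal (\<kappa> * (2 * L2_inner M g g)) \<le> ennreal (2 * dirichlet_form M (kernel_op K) g)"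
    by (intro ennreal_leI) simp
  then have "ennreal \<kappa> * kernel_energy M (\<lambda>_. M) g \<le> kernel_energy M K g"
    using \<kappa> L2_0D(1,2)[OF g]
    by (simp add: kernel_energy_eq_dirichlet_form const.kernel_energy_eq_dirichlet_form const_eq
        ennreal_mult L2_inner_nonneg)
  then show ?thesis by (simp add: g_def[abs_def] kernel_energy_shift)
qed

section \<open>Off-diagonal domination at a single point\<close>

text \<open>As \<open>g\<close> vanishes at \<open>(y, z)\<close>, the atom at \<open>y\<close> can
  be removed from \<open>L\<close> at no cost. The hypothesis is then an inequality between measures
  on \<open>Y\<close>, which passes to integrals of nonnegative functions; the mass of
  \<open>N\<close> off the fibre over \<open>z\<close> only adds to the right side.\<close>

lemma nn_integral_off_diagonal_le:
  fixes N :: "('y \<times> 'z) measure" and L :: "'y measure" and g :: "'y \<times> 'z \<Rightarrow> ennreal"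
  assumes N: "prob_space N" "sets N = sets (Y \<Otimes>\<^sub>M Z)" and L: "prob_space L" "sets L = sets Y"
    and yz: "{y} \<in> sets Y" "{z} \<in> sets Z" and c: "0 \<le> c"
    and le: "\<And>B. B \<in> sets Y \<Longrightarrow> c * measure L (B - {y}) \<le> measure N ((B - {y}) \<times> {z})"
    and g: "g \<in> borel_measurable (Y \<Otimes>\<^sub>M Z)" and g0: "g (y, z) = 0"
  shows "ennreal c * (\<integral>\<^sup>+y'. g (y', z) \<partial>L) \<le> (\<integral>\<^sup>+w. g w \<partial>N)"
proof -
  interpret N: prob_space N by fact
  interpret L: prob_space L by fact
  have z: "z \<in> space Z" using yz(2) sets.sets_into_space by blast
  have [measurable_cong]: "sets N = sets (Y \<Otimes>\<^sub>M Z)" "sets L = sets Y" by fact+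
  have sp: "space N = space Y \<times> space Z" "space L = space Y"
    using sets_eq_imp_space_eq[OF N(2)] sets_eq_imp_space_eq[OF L(2)] by (auto simp: space_pair_measure)
  have [measurable]: "g \<in> borel_measurable (Y \<Otimes>\<^sub>M Z)" "{y} \<in> sets Y" "{z} \<in> sets Z" by fact+
  have gz [measurable]: "(\<lambda>y'. g (y', z)) \<in> borel_measurable Y" using z by measurable
  define D where "D = space Y - {y}"
  have [measurable]: "D \<in> sets Y" unfolding D_def by measurable
  have Dz [measurable]: "D \<times> {z} \<in> sets (Y \<Otimes>\<^sub>M Z)" by measurable
  \<comment> \<open>\<open>\<nu>\<close> is the part of \<open>N\<close> on the punctured fibre,
    projected to \<open>Y\<close>; \<open>\<mu>\<close> is \<open>c\<close> times the part of
    \<open>L\<close> off \<open>y\<close>. The hypothesis \<open>le\<close> says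
    \<open>\<mu> \<le> \<nu>\<close> set by set.\<close>
  define \<nu> where "\<nu> = distr (density N (indicator (D \<times> {z}))) Y fst"
  define \<mu> where "\<mu> = scale_measure (ennreal c) (density L (indicator D))"
  have sets_\<nu>: "sets \<nu> = sets Y" and sets_\<mu>: "sets \<mu> = sets Y" by (auto simp: \<nu>_def \<mu>_def L)
  have "\<mu> \<le> \<nu>"
  proof (subst le_measure)
    show "sets \<mu> = sets \<nu>" by (simp add: sets_\<nu> sets_\<mu>)
    show "\<forall>B\<in>sets \<mu>. emeasure \<mu> B \<le> emeasure \<nu> B"
    proof
      fix B assume "B \<in> sets \<mu>"
      then have B [measurable]: "B \<in> sets Y" by (simp add: sets_\<mu>)
      have B_eq: "D \<inter> B = B - {y}" using sets.sets_into_space[OF B] by (auto simp: D_def)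
      have vim: "(D \<times> {z}) \<inter> (fst -` B \<inter> space N) = (B - {y}) \<times> {z}"
        using sets.sets_into_space[OF B] z by (auto simp: D_def sp)
      have "emeasure \<mu> B = ennreal c * emeasure L (B - {y})"
        unfolding \<mu>_def using B_eq
        by (simp add: emeasure_density indicator_inter_arith[symmetric] L)
      also have "\<dots> = ennreal (c * measure L (B - {y}))"
        by (simp add: L.emeasure_eq_measure ennreal_mult c)
      also have "\<dots> \<le> ennreal (measure N ((B - {y}) \<times> {z}))"
        by (intro ennreal_leI le B)
      also have "\<dots> = (\<integral>\<^sup>+w. indicator ((D \<times> {z}) \<inter> (fst -` B \<inter> space N)) w \<partial>N)"
        unfolding vim using N by (simp add: N.emeasure_eq_measure)
      also have "\<dots> = emeasure \<nu> B"
      proof -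
        have fst: "fst -` B \<inter> space N \<in> sets N" by measurable
        have "indicator (D \<times> {z}) \<in> borel_measurable N" by measurable
        then have "emeasure \<nu> B =
            (\<integral>\<^sup>+w. indicator (D \<times> {z}) w * indicator (fst -` B \<inter> space N) w \<partial>N)"
          unfolding \<nu>_def
          by (subst emeasure_distr) (simp_all add: emeasure_density fst)
        then show ?thesis by (simp only: indicator_inter_arith)
      qed
      finally show "emeasure \<mu> B \<le> emeasure \<nu> B" .
    qed
  qed
  then have mono: "(\<integral>\<^sup>+y'. g (y', z) \<partial>\<mu>) \<le> (\<integral>\<^sup>+y'. g (y', z) \<partial>\<nu>)"
    by (intro nn_integral_mono_measure) (simp_all add: sets_\<nu> sets_\<mu>)
  have "(\<integral>\<^sup>+y'. g (y', z) \<partial>\<mu>) = ennreal c * (\<integral>\<^sup>+y'. indicator D y' * g (y', z) \<partial>L)"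
    unfolding \<mu>_def by (simp add: nn_integral_scale_measure nn_integral_density)
  also have "(\<integral>\<^sup>+y'. indicator D y' * g (y', z) \<partial>L) = (\<integral>\<^sup>+y'. g (y', z) \<partial>L)"
    using g0 by (intro nn_integral_cong) (auto simp: D_def sp split: split_indicator)
  finally have "ennreal c * (\<integral>\<^sup>+y'. g (y', z) \<partial>L) \<le> (\<integral>\<^sup>+y'. g (y', z) \<partial>\<nu>)"
    using mono by simp
  also have "\<dots> = (\<integral>\<^sup>+w. indicator (D \<times> {z}) w * g (fst w, z) \<partial>N)"
    unfolding \<nu>_def using z by (simp add: nn_integral_distr nn_integral_density)
  also have "\<dots> \<le> (\<integral>\<^sup>+w. g w \<partial>N)"
    by (intro nn_integral_mono) (auto split: split_indicator)
  finally show ?thesis .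
qed

section \<open>Fibre kernels and disintegration\<close>

text \<open>A product with a point mass is a push-forward along the embedding of the fibre. In this
  form measurability and integrals are governed by the rules for \<open>distr\<close>.\<close>

lemma fibre_kernel_eq_distr:
  assumes "z \<in> space Z" and L: "prob_space (R z y)" "sets (R z y) = sets Y"
  shows "fibre_kernel Z R (y, z) = distr (R z y) (Y \<Otimes>\<^sub>M Z) (\<lambda>y'. (y', z))"
proof (rule measure_eqI)
  have [measurable_cong]: "sets (R z y) = sets Y" by fact
  have sp: "space (R z y) = space Y" using L(2) by (rule sets_eq_imp_space_eq)
  have sets_eq: "sets (R z y \<Otimes>\<^sub>M return Z z) = sets (Y \<Otimes>\<^sub>M Z)"
    by (intro sets_pair_measure_cong L sets_return)
  then show "sets (fibre_kernel Z R (y, z)) = sets (distr (R z y) (Y \<Otimes>\<^sub>M Z) (\<lambda>y'. (y', z)))"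
    by (simp only: fibre_kernel_def prod.case sets_distr)
  interpret ret: prob_space "return Z z" using assms(1) by (rule prob_space_return)
  fix A assume "A \<in> sets (fibre_kernel Z R (y, z))"
  then have A: "A \<in> sets (R z y \<Otimes>\<^sub>M return Z z)" and A' [measurable]: "A \<in> sets (Y \<Otimes>\<^sub>M Z)"
    using sets_eq by (auto simp: fibre_kernel_def)
  have "emeasure (fibre_kernel Z R (y, z)) A = (\<integral>\<^sup>+y'. \<integral>\<^sup>+z'. indicator A (y', z') \<partial>return Z z \<partial>R z y)"
    using ret.emeasure_pair_measure[OF A] by (simp add: fibre_kernel_def)
  also have "\<dots> = (\<integral>\<^sup>+y'. indicator A (y', z) \<partial>R z y)"
    using assms(1) by (intro nn_integral_cong nn_integral_return) (auto simp: sp)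
  also have "\<dots> = (\<integral>\<^sup>+y'. indicator ((\<lambda>y'. (y', z)) -` A \<inter> space (R z y)) y' \<partial>R z y)"
    by (intro nn_integral_cong) (auto split: split_indicator)
  also have "\<dots> = emeasure (distr (R z y) (Y \<Otimes>\<^sub>M Z) (\<lambda>y'. (y', z))) A"
    using assms(1) by (simp add: emeasure_distr)
  finally show "emeasure (fibre_kernel Z R (y, z)) A =
      emeasure (distr (R z y) (Y \<Otimes>\<^sub>M Z) (\<lambda>y'. (y', z))) A" .
qed

locale disintegration = prob_space \<pi>' for \<pi>' :: "('y \<times> 'z) measure" +
  fixes Y :: "'y measure" and Z :: "'z measure" and \<omega> :: "'z measure" and \<omega>z :: "'z \<Rightarrow> 'y measure"
  assumes sets_eq [measurable_cong]: "sets \<pi>' = sets (Y \<Otimes>\<^sub>M Z)"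
    and marginal: "\<omega> = distr \<pi>' Z snd"
    and conditional [measurable]: "\<omega>z \<in> Z \<rightarrow>\<^sub>M prob_algebra Y"
    and emeasure_disint: "\<And>A. A \<in> sets (Y \<Otimes>\<^sub>M Z) \<Longrightarrow>
      emeasure \<pi>' A = (\<integral>\<^sup>+z. emeasure (\<omega>z z) {y. (y, z) \<in> A} \<partial>\<omega>)"
begin

lemma space_eq: "space \<pi>' = space Y \<times> space Z"
  using sets_eq_imp_space_eq[OF sets_eq] by (simp add: space_pair_measure)

lemma sets_marginal [measurable_cong]: "sets \<omega> = sets Z" and space_marginal: "space \<omega> = space Z"
  by (simp_all add: marginal)

lemma prob_space_marginal: "prob_space \<omega>"
  unfolding marginal by (intro prob_space_distr) measurable

lemma conditional_prob_space: "z \<in> space Z \<Longrightarrow> prob_space (\<omega>z z)"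
  and sets_conditional: "z \<in> space Z \<Longrightarrow> sets (\<omega>z z) = sets Y"
  using measurable_space[OF conditional] by (auto simp: space_prob_algebra)

lemma measurable_conditional:
  "z \<in> space Z \<Longrightarrow> f \<in> Y \<rightarrow>\<^sub>M N \<Longrightarrow> f \<in> \<omega>z z \<rightarrow>\<^sub>M N"
  using measurable_cong_sets[OF sets_conditional refl, of z N] by auto

text \<open>The disintegration formula for sets says that \<open>\<pi>'\<close> is the bind of
  \<open>\<omega>\<close> with the kernel \<open>F\<close> that places \<open>\<omega>z z\<close> on
  the fibre over \<open>z\<close>; integration against a bind then extends it to functions.\<close>

lemma nn_integral_disint:
  assumes h [measurable]: "h \<in> borel_measurable (Y \<Otimes>\<^sub>M Z)"
  shows "(\<integral>\<^sup>+w. h w \<partial>\<pi>') = (\<integral>\<^sup>+z. \<integral>\<^sup>+y. h (y, z) \<partial>\<omega>z z \<partial>\<omega>)"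
proof -
  define F where "F z = distr (\<omega>z z) (Y \<Otimes>\<^sub>M Z) (\<lambda>y. (y, z))" for z
  have F_prob: "F \<in> \<omega> \<rightarrow>\<^sub>M prob_algebra (Y \<Otimes>\<^sub>M Z)" unfolding F_def by measurable
  then have F: "F \<in> \<omega> \<rightarrow>\<^sub>M subprob_algebra (Y \<Otimes>\<^sub>M Z)" by (rule measurable_prob_algebraD)
  interpret \<omega>: prob_space \<omega> by (rule prob_space_marginal)
  have Pair: "(\<lambda>y. (y, z)) \<in> \<omega>z z \<rightarrow>\<^sub>M Y \<Otimes>\<^sub>M Z" if "z \<in> space \<omega>" for z
    using that by (intro measurable_conditional) (auto simp: space_marginal)
  have "\<pi>' = \<omega> \<bind> F"
  proof (rule measure_eqI)
    show "sets \<pi>' = sets (\<omega> \<bind> F)"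
      using sets_bind[of \<omega> F "Y \<Otimes>\<^sub>M Z"] \<omega>.not_empty by (simp add: F_def sets_eq)
    fix A assume "A \<in> sets \<pi>'"
    then have A: "A \<in> sets (Y \<Otimes>\<^sub>M Z)" by (simp add: sets_eq)
    have "emeasure (\<omega> \<bind> F) A = (\<integral>\<^sup>+z. emeasure (F z) A \<partial>\<omega>)"
      by (rule emeasure_bind[OF \<omega>.not_empty F A])
    also have "\<dots> = (\<integral>\<^sup>+z. emeasure (\<omega>z z) {y. (y, z) \<in> A} \<partial>\<omega>)"
    proof (intro nn_integral_cong)
      fix z assume z: "z \<in> space \<omega>"
      have "(\<lambda>y. (y, z)) -` A \<inter> space (\<omega>z z) = {y. (y, z) \<in> A}"
        using sets.sets_into_space[OF A] sets_eq_imp_space_eq[OF sets_conditional] z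
        by (auto simp: space_pair_measure space_marginal)
      then show "emeasure (F z) A = emeasure (\<omega>z z) {y. (y, z) \<in> A}"
        using Pair[OF z] A by (simp add: F_def emeasure_distr)
    qed
    finally show "emeasure \<pi>' A = emeasure (\<omega> \<bind> F) A" using emeasure_disint[OF A] by simp
  qed
  then have "(\<integral>\<^sup>+w. h w \<partial>\<pi>') = (\<integral>\<^sup>+z. \<integral>\<^sup>+w. h w \<partial>F z \<partial>\<omega>)"
    using nn_integral_bind[OF h F] by simp
  also have "\<dots> = (\<integral>\<^sup>+z. \<integral>\<^sup>+y. h (y, z) \<partial>\<omega>z z \<partial>\<omega>)"
    by (intro nn_integral_cong) (simp add: F_def nn_integral_distr[OF Pair])
  finally show ?thesis .
qed

end

text \<open>\<open>R\<close> is a parameter because two families are needed: the given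
  \<open>Qz\<close>, and the family that resamples \<open>y\<close> from
  \<open>\<omega>z z\<close>.\<close>

locale fibre_kernels = disintegration +
  fixes R :: "'b \<Rightarrow> 'a \<Rightarrow> 'a measure"
  assumes R_measurable: "(\<lambda>(y, z). R z y) \<in> Y \<Otimes>\<^sub>M Z \<rightarrow>\<^sub>M prob_algebra Y"
    and R_invariant: "AE z in \<omega>. \<omega>z z \<bind> R z = \<omega>z z"
begin

lemma fibre_kernel_eq:
  assumes "y \<in> space Y" "z \<in> space Z"
  shows "fibre_kernel Z R (y, z) = distr (R z y) (Y \<Otimes>\<^sub>M Z) (\<lambda>y'. (y', z))"
  using measurable_space[OF R_measurable, of "(y, z)"] assms
  by (intro fibre_kernel_eq_distr) (auto simp: space_prob_algebra space_pair_measure)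

lemma R_section: "z \<in> space Z \<Longrightarrow> R z \<in> Y \<rightarrow>\<^sub>M prob_algebra Y"
  using measurable_compose[OF measurable_Pair2' R_measurable] by simp

lemma nn_integral_fibre_kernel:
  assumes "y \<in> space Y" "z \<in> space Z" "h \<in> borel_measurable (Y \<Otimes>\<^sub>M Z)"
  shows "(\<integral>\<^sup>+w. h w \<partial>fibre_kernel Z R (y, z)) = (\<integral>\<^sup>+y'. h (y', z) \<partial>R z y)"
proof -
  have "sets (R z y) = sets Y"
    using measurable_space[OF R_section, of z y] assms by (auto simp: space_prob_algebra)
  note [measurable_cong] = this
  show ?thesis
    using assms by (simp add: fibre_kernel_eq nn_integral_distr)
qed

lemma markov_kernel_fibre: "markov_kernel \<pi>' (fibre_kernel Z R)"
proof -
  have [measurable]: "(\<lambda>w. R (snd w) (fst w)) \<in> Y \<Otimes>\<^sub>M Z \<rightarrow>\<^sub>M prob_algebra Y"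
    using R_measurable by (simp add: case_prod_beta')
  define F where "F w = distr (R (snd w) (fst w)) (Y \<Otimes>\<^sub>M Z) (\<lambda>y'. (y', snd w))" for w
  have "F \<in> Y \<Otimes>\<^sub>M Z \<rightarrow>\<^sub>M prob_algebra (Y \<Otimes>\<^sub>M Z)"
    unfolding F_def by measurable
  moreover have "fibre_kernel Z R w = F w" if "w \<in> space (Y \<Otimes>\<^sub>M Z)" for w
    using that fibre_kernel_eq[of "fst w" "snd w"] by (simp add: F_def space_pair_measure mem_Times_iff)
  ultimately have "fibre_kernel Z R \<in> Y \<Otimes>\<^sub>M Z \<rightarrow>\<^sub>M prob_algebra (Y \<Otimes>\<^sub>M Z)"
    by (simp only: measurable_cong[of "Y \<Otimes>\<^sub>M Z" "fibre_kernel Z R" F])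
  \<comment> \<open>\<open>prob_algebra\<close> depends on its argument only through the
    sigma-algebra.\<close>
  moreover have "prob_algebra \<pi>' = prob_algebra (Y \<Otimes>\<^sub>M Z)"
    by (simp add: prob_algebra_def subprob_algebra_cong[OF sets_eq])
  ultimately show ?thesis
    by (simp add: markov_kernel_def measurable_cong_sets[OF sets_eq refl])
qed

lemma fibre_invariant_kernel: "AE z in \<omega>. invariant_kernel (\<omega>z z) (R z)"
proof -
  have "AE z in \<omega>. z \<in> space Z" using AE_space[of \<omega>] by (simp add: space_marginal)
  with R_invariant show ?thesis
  proof eventually_elim
    case (elim z)
    have alg: "prob_algebra (\<omega>z z) = prob_algebra Y"
      by (simp add: prob_algebra_def subprob_algebra_cong[OF sets_conditional[OF elim(2)]])
    have "markov_kernel (\<omega>z z) (R z)"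
      unfolding markov_kernel_def alg by (rule measurable_conditional[OF elim(2) R_section[OF elim(2)]])
    then show ?case
      using elim(1) conditional_prob_space[OF elim(2)]
      by (simp add: invariant_kernel_def invariant_kernel_axioms_def)
  qed
qed

text \<open>The kernel never changes \<open>z\<close>, and for almost every \<open>z\<close> the
  move inside the fibre preserves \<open>\<omega>z z\<close>; integrating over
  \<open>\<omega>\<close> reassembles \<open>\<pi>'\<close>.\<close>

lemma invariant_fibre_kernel: "invariant_kernel \<pi>' (fibre_kernel Z R)"
proof -
  have K: "fibre_kernel Z R \<in> \<pi>' \<rightarrow>\<^sub>M subprob_algebra \<pi>'"
    using markov_kernel_fibre by (simp add: markov_kernel_def measurable_prob_algebraD)
  have "\<pi>' \<bind> fibre_kernel Z R = \<pi>'"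
  proof (rule measure_eqI)
    show sets_bind_eq: "sets (\<pi>' \<bind> fibre_kernel Z R) = sets \<pi>'"
      using subprob_measurableD(2)[OF K] not_empty by (intro sets_bind)
    fix A assume "A \<in> sets (\<pi>' \<bind> fibre_kernel Z R)"
    then have A: "A \<in> sets \<pi>'" and A' [measurable]: "A \<in> sets (Y \<Otimes>\<^sub>M Z)"
      using sets_bind_eq sets_eq by auto
    have ind: "(indicator A :: _ \<Rightarrow> ennreal) \<in> borel_measurable (Y \<Otimes>\<^sub>M Z)" by simp
    have "emeasure (\<pi>' \<bind> fibre_kernel Z R) A = (\<integral>\<^sup>+w. emeasure (fibre_kernel Z R w) A \<partial>\<pi>')"
      by (rule emeasure_bind[OF not_empty K A])
    also have "\<dots> = (\<integral>\<^sup>+z. \<integral>\<^sup>+y. emeasure (fibre_kernel Z R (y, z)) A \<partial>\<omega>z z \<partial>\<omega>)"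
      using measurable_emeasure_kernel[OF K A]
      by (intro nn_integral_disint) (simp only: measurable_cong_sets[OF sets_eq refl])
    also have "\<dots> = (\<integral>\<^sup>+z. \<integral>\<^sup>+y. indicator A (y, z) \<partial>\<omega>z z \<partial>\<omega>)"
    proof (rule nn_integral_cong_AE)
      have "AE z in \<omega>. z \<in> space Z" using AE_space[of \<omega>] by (simp add: space_marginal)
      with fibre_invariant_kernel
      show "AE z in \<omega>. (\<integral>\<^sup>+y. emeasure (fibre_kernel Z R (y, z)) A \<partial>\<omega>z z) =
          (\<integral>\<^sup>+y. indicator A (y, z) \<partial>\<omega>z z)"
      proof eventually_elim
        case (elim z)
        have sp: "space (\<omega>z z) = space Y"
          using sets_eq_imp_space_eq[OF sets_conditional[OF elim(2)]] .
        have "(\<integral>\<^sup>+y. emeasure (fibre_kernel Z R (y, z)) A \<partial>\<omega>z z) =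
            (\<integral>\<^sup>+y. \<integral>\<^sup>+y'. indicator A (y', z) \<partial>R z y \<partial>\<omega>z z)"
        proof (intro nn_integral_cong)
          fix y assume "y \<in> space (\<omega>z z)"
          then have y: "y \<in> space Y" by (simp add: sp)
          have "A \<in> sets (fibre_kernel Z R (y, z))"
            using A' y elim(2) by (simp add: fibre_kernel_eq)
          then show "emeasure (fibre_kernel Z R (y, z)) A = (\<integral>\<^sup>+y'. indicator A (y', z) \<partial>R z y)"
            using nn_integral_fibre_kernel[OF y elim(2) ind] by simp
        qed
        also have "\<dots> = (\<integral>\<^sup>+y. indicator A (y, z) \<partial>\<omega>z z)"
          using elim(2)
          by (intro invariant_kernel.nn_integral_kernel[OF elim(1)] measurable_conditional) auto
        finally show ?case .
      qed
    qed
    also have "\<dots> = emeasure \<pi>' A"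
      using nn_integral_disint[OF ind] A by simp
    finally show "emeasure (\<pi>' \<bind> fibre_kernel Z R) A = emeasure \<pi>' A" .
  qed
  then show ?thesis
    using markov_kernel_fibre prob_space_axioms
    by (simp add: invariant_kernel_def invariant_kernel_axioms_def)
qed

lemma kernel_energy_fibre_kernel:
  assumes h [measurable]: "h \<in> borel_measurable (Y \<Otimes>\<^sub>M Z)"
  shows "kernel_energy \<pi>' (fibre_kernel Z R) h = (\<integral>\<^sup>+z. kernel_energy (\<omega>z z) (R z) (\<lambda>y. h (y, z)) \<partial>\<omega>)"
proof -
  have R' [measurable]: "(\<lambda>w. R (snd w) (fst w)) \<in> Y \<Otimes>\<^sub>M Z \<rightarrow>\<^sub>M subprob_algebra Y"
    using measurable_prob_algebraD[OF R_measurable] by (simp add: case_prod_beta')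
  have "kernel_energy \<pi>' (fibre_kernel Z R) h =
      (\<integral>\<^sup>+w. \<integral>\<^sup>+y'. ennreal ((h w - h (y', snd w))\<^sup>2) \<partial>R (snd w) (fst w) \<partial>\<pi>')"
    unfolding kernel_energy_def
  proof (intro nn_integral_cong)
    fix w assume "w \<in> space \<pi>'"
    then have w: "fst w \<in> space Y" "snd w \<in> space Z" by (auto simp: space_eq)
    show "(\<integral>\<^sup>+w'. ennreal ((h w - h w')\<^sup>2) \<partial>fibre_kernel Z R w) =
        (\<integral>\<^sup>+y'. ennreal ((h w - h (y', snd w))\<^sup>2) \<partial>R (snd w) (fst w))"
      using nn_integral_fibre_kernel[OF w, of "\<lambda>w'. ennreal ((h w - h w')\<^sup>2)"] by simp
  qed
  also have "\<dots> = (\<integral>\<^sup>+z. \<integral>\<^sup>+y. \<integral>\<^sup>+y'. ennreal ((h (y, z) - h (y', z))\<^sup>2) \<partial>R z y \<partial>\<omega>z z \<partial>\<omega>)"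
  proof (subst nn_integral_disint)
    show "(\<lambda>w. \<integral>\<^sup>+y'. ennreal ((h w - h (y', snd w))\<^sup>2) \<partial>R (snd w) (fst w)) \<in> borel_measurable (Y \<Otimes>\<^sub>M Z)"
      by (rule nn_integral_measurable_subprob_algebra2[OF _ R']) measurable
  qed simp
  finally show ?thesis by (simp add: kernel_energy_def)
qed

lemma dirichlet_form_ge_fibre_kernel:
  assumes Q: "invariant_kernel \<pi>' Q"
    and singletons: "\<And>y. y \<in> space Y \<Longrightarrow> {y} \<in> sets Y" "\<And>z. z \<in> space Z \<Longrightarrow> {z} \<in> sets Z"
    and c: "0 \<le> c"
    and le: "AE (y, z) in \<pi>'. \<forall>B\<in>sets Y.
      c * measure (R z y) (B - {y}) \<le> measure (Q (y, z)) ((B - {y}) \<times> {z})"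
    and h: "h \<in> borel_measurable \<pi>'" "integrable \<pi>' (\<lambda>w. (h w)\<^sup>2)"
  shows "c * dirichlet_form \<pi>' (kernel_op (fibre_kernel Z R)) h \<le> dirichlet_form \<pi>' (kernel_op Q) h"
proof (rule kernel_energy_le_imp_dirichlet_form_le[OF invariant_fibre_kernel Q h c])
  interpret Q: invariant_kernel \<pi>' Q by fact
  interpret R: invariant_kernel \<pi>' "fibre_kernel Z R" by (rule invariant_fibre_kernel)
  have h' [measurable]: "h \<in> borel_measurable (Y \<Otimes>\<^sub>M Z)"
    using h(1) by (simp only: measurable_cong_sets[OF sets_eq refl])
  have "ennreal c * kernel_energy \<pi>' (fibre_kernel Z R) h =
      (\<integral>\<^sup>+w. ennreal c * (\<integral>\<^sup>+w'. ennreal ((h w - h w')\<^sup>2) \<partial>fibre_kernel Z R w) \<partial>\<pi>')"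
    unfolding kernel_energy_def
    by (rule nn_integral_cmult[symmetric]) (rule R.kernel_energy_integrand_measurable[OF h(1)])
  also have "\<dots> \<le> kernel_energy \<pi>' Q h"
    unfolding kernel_energy_def
  proof (rule nn_integral_mono_AE)
    have "AE w in \<pi>'. w \<in> space \<pi>'" by simp
    with le show "AE w in \<pi>'. ennreal c * (\<integral>\<^sup>+w'. ennreal ((h w - h w')\<^sup>2) \<partial>fibre_kernel Z R w) \<le>
        (\<integral>\<^sup>+w'. ennreal ((h w - h w')\<^sup>2) \<partial>Q w)"
    proof eventually_elim
      case (elim w)
      obtain y z where w: "w = (y, z)" by (cases w)
      have yz: "y \<in> space Y" "z \<in> space Z" using elim(2) by (auto simp: w space_eq)
      have L: "prob_space (R z y)" "sets (R z y) = sets Y"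
        using measurable_space[OF R_section[OF yz(2)] yz(1)] by (auto simp: space_prob_algebra)
      have "ennreal c * (\<integral>\<^sup>+y'. ennreal ((h (y, z) - h (y', z))\<^sup>2) \<partial>R z y) \<le>
          (\<integral>\<^sup>+w'. ennreal ((h (y, z) - h w')\<^sup>2) \<partial>Q (y, z))"
      \<comment> \<open>The integrand \<open>(h (y, z) - h w')\<^sup>2\<close>, as a function of
        \<open>w'\<close>, vanishes at \<open>(y, z)\<close>.\<close>
      proof (rule nn_integral_off_diagonal_le[where Y=Y and Z=Z])
        show "prob_space (Q (y, z))" "sets (Q (y, z)) = sets (Y \<Otimes>\<^sub>M Z)"
          using Q.kernel_prob_space[OF elim(2)] Q.kernel_sets[OF elim(2)] sets_eq by (simp_all add: w)
        show "c * measure (R z y) (B - {y}) \<le> measure (Q (y, z)) ((B - {y}) \<times> {z})" if "B \<in> sets Y" for B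
          using elim(1) that by (simp add: w)
      qed (use L yz singletons c in auto)
      then show ?case
        using nn_integral_fibre_kernel[OF yz, of "\<lambda>w'. ennreal ((h w - h w')\<^sup>2)"] by (simp add: w)
    qed
  qed
  finally show "ennreal c * kernel_energy \<pi>' (fibre_kernel Z R) h \<le> kernel_energy \<pi>' Q h" .
qed

end

section \<open>Conditional expectation as a fibre kernel, and the fibrewise gap\<close>

context disintegration
begin

lemma conditional_fibre_kernels: "fibre_kernels \<pi>' Y Z \<omega> \<omega>z (\<lambda>z y. \<omega>z z)"
proof -
  have "AE z in \<omega>. z \<in> space Z" using AE_space[of \<omega>] by (simp add: space_marginal)
  then have "AE z in \<omega>. \<omega>z z \<bind> (\<lambda>_. \<omega>z z) = \<omega>z z"
    by eventually_elim
      (rule invariant_kernel.invariant[OF const_invariant_kernel[OF conditional_prob_space]])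
  then show ?thesis
    using disintegration_axioms by (simp add: fibre_kernels_def fibre_kernels_axioms_def)
qed

text \<open>Both sides average \<open>h\<close> over the fibre through \<open>w\<close>. Hence
  \<open>E\<^sup>*E\<close> is a Markov operator to which the energy lemmas apply. Off
  \<open>space \<pi>'\<close> nothing is known about \<open>\<omega>z\<close>.\<close>

lemma kernel_op_conditional:
  assumes "h \<in> borel_measurable \<pi>'" "w \<in> space \<pi>'"
  shows "kernel_op (fibre_kernel Z (\<lambda>z y. \<omega>z z)) h w = fibre_lift (fibre_mean \<omega>z h) w"
proof -
  interpret fibre_kernels \<pi>' Y Z \<omega> \<omega>z "\<lambda>z y. \<omega>z z" by (rule conditional_fibre_kernels)
  obtain y z where w: "w = (y, z)" by (cases w)
  have yz: "y \<in> space Y" "z \<in> space Z" using assms(2) by (auto simp: w space_eq)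
  have h: "h \<in> borel_measurable (Y \<Otimes>\<^sub>M Z)"
    using assms(1) by (simp only: measurable_cong_sets[OF sets_eq refl])
  have "(\<lambda>y'. (y', z)) \<in> \<omega>z z \<rightarrow>\<^sub>M Y \<Otimes>\<^sub>M Z"
    by (rule measurable_conditional[OF yz(2) measurable_Pair2'[OF yz(2)]])
  then show ?thesis
    unfolding w kernel_op_def fibre_kernel_eq[OF yz]
    by (simp add: integral_distr[OF _ h] fibre_lift_def fibre_mean_def)
qed

end

context fibre_kernels
begin

text \<open>Each gap bounds the energy of \<open>R z\<close> on the section of \<open>h\<close> over
  \<open>z\<close> below by \<open>\<kappa>\<close> times twice the variance of that section;
  integration over \<open>\<omega>\<close> gives the global bound.\<close>

lemma dirichlet_form_fibre_kernel_ge: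
  assumes gap: "AE z in \<omega>. ereal \<kappa> \<le> spectral_gap (\<omega>z z) (kernel_op (R z))" and \<kappa>: "0 \<le> \<kappa>"
    and h: "h \<in> borel_measurable \<pi>'" "integrable \<pi>' (\<lambda>w. (h w)\<^sup>2)"
  shows "\<kappa> * dirichlet_form \<pi>' (kernel_op (fibre_kernel Z (\<lambda>z y. \<omega>z z))) h
    \<le> dirichlet_form \<pi>' (kernel_op (fibre_kernel Z R)) h"
proof -
  interpret mean: fibre_kernels \<pi>' Y Z \<omega> \<omega>z "\<lambda>z y. \<omega>z z" by (rule conditional_fibre_kernels)
  have h' [measurable]: "h \<in> borel_measurable (Y \<Otimes>\<^sub>M Z)"
    using h(1) by (simp only: measurable_cong_sets[OF sets_eq refl])
  have cond [measurable]: "\<omega>z \<in> \<omega> \<rightarrow>\<^sub>M subprob_algebra Y"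
    using measurable_prob_algebraD[OF conditional]
    by (simp only: measurable_cong_sets[OF sets_marginal refl])
  \<comment> \<open>Measurability in \<open>z\<close> of the resampling energy lets
    \<open>\<kappa>\<close> move under the integral over \<open>\<omega>\<close>. The coordinates
    are swapped because the parameter comes first in the measurability rule for kernels.\<close>
  have "(\<lambda>w. \<integral>\<^sup>+y'. ennreal ((h (snd w, fst w) - h (y', fst w))\<^sup>2) \<partial>\<omega>z (fst w))
      \<in> borel_measurable (\<omega> \<Otimes>\<^sub>M Y)"
    by (rule nn_integral_measurable_subprob_algebra2[where N=Y]) measurable
  then have meas: "(\<lambda>z. kernel_energy (\<omega>z z) (\<lambda>_. \<omega>z z) (\<lambda>y. h (y, z))) \<in> borel_measurable \<omega>"
    unfolding kernel_energy_def
    by (intro nn_integral_measurable_subprob_algebra2[OF _ cond]) (simp add: case_prod_beta')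
  \<comment> \<open>Since \<open>h\<close> is square-integrable, disintegration makes almost every
    section square-integrable, as the gap inequality on the fibre requires.\<close>
  have "(\<integral>\<^sup>+z. \<integral>\<^sup>+y. ennreal ((h (y, z))\<^sup>2) \<partial>\<omega>z z \<partial>\<omega>) = (\<integral>\<^sup>+w. ennreal ((h w)\<^sup>2) \<partial>\<pi>')"
    by (rule nn_integral_disint[symmetric]) measurable
  also have "\<dots> \<noteq> \<infinity>" using h(2) by (simp add: nn_integral_eq_integral)
  finally have fin: "AE z in \<omega>. (\<integral>\<^sup>+y. ennreal ((h (y, z))\<^sup>2) \<partial>\<omega>z z) \<noteq> \<infinity>"
    by (rule nn_integral_PInf_AE[rotated])
      (rule nn_integral_measurable_subprob_algebra2[OF _ cond], measurable)
  have space: "AE z in \<omega>. z \<in> space Z" using AE_space[of \<omega>] by (simp add: space_marginal)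
  have "ennreal \<kappa> * kernel_energy \<pi>' (fibre_kernel Z (\<lambda>z y. \<omega>z z)) h =
      (\<integral>\<^sup>+z. ennreal \<kappa> * kernel_energy (\<omega>z z) (\<lambda>_. \<omega>z z) (\<lambda>y. h (y, z)) \<partial>\<omega>)"
    unfolding mean.kernel_energy_fibre_kernel[OF h'] by (rule nn_integral_cmult[symmetric, OF meas])
  also have "\<dots> \<le> (\<integral>\<^sup>+z. kernel_energy (\<omega>z z) (R z) (\<lambda>y. h (y, z)) \<partial>\<omega>)"
  proof (rule nn_integral_mono_AE)
    show "AE z in \<omega>. ennreal \<kappa> * kernel_energy (\<omega>z z) (\<lambda>_. \<omega>z z) (\<lambda>y. h (y, z))
        \<le> kernel_energy (\<omega>z z) (R z) (\<lambda>y. h (y, z))"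
      using gap fibre_invariant_kernel fin space
    proof eventually_elim
      case (elim z)
      have hz: "(\<lambda>y. h (y, z)) \<in> borel_measurable (\<omega>z z)"
        using elim(4) by (intro measurable_conditional[OF elim(4)]) measurable
      have "integrable (\<omega>z z) (\<lambda>y. (h (y, z))\<^sup>2)"
        using hz elim(3) by (intro integrableI_bounded) (auto simp: less_top[symmetric])
      then show ?case
        using spectral_gap_kernel_energy[OF elim(2,1) \<kappa> hz] by simp
    qed
  qed
  also have "\<dots> = kernel_energy \<pi>' (fibre_kernel Z R) h"
    by (rule kernel_energy_fibre_kernel[OF h', symmetric])
  finally show ?thesis
    by (rule kernel_energy_le_imp_dirichlet_form_le[OF mean.invariant_fibre_kernel
          invariant_fibre_kernel h \<kappa>])
qed

end

section \<open>Compression by \<open>P\<close> and the two inequalities\<close>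

lemma L2_0_cong:
  assumes "\<And>w. w \<in> space M \<Longrightarrow> f w = g w" "f \<in> L2_0 M" shows "g \<in> L2_0 M"
  using assms measurable_cong[of M f g borel]
    Bochner_Integration.integrable_cong[of M M "\<lambda>x. (f x)\<^sup>2" "\<lambda>x. (g x)\<^sup>2"]
    Bochner_Integration.integral_cong[of M M f g]
  by (simp add: L2_0_def)

text \<open>Moving the adjoint across the inner product turns the quadratic term into that of
  \<open>J\<close> at \<open>T f\<close>, so the two forms differ only in their norm terms.\<close>

lemma dirichlet_form_compression:
  assumes "prob_space M" "prob_space N" "L2_0_linear M N T"
    and "\<And>f. f \<in> L2_0 M \<Longrightarrow> L2_norm N (T f) \<le> L2_norm M f"
    and "f \<in> L2_0 M" "J (T f) \<in> L2_0 N"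
  shows "dirichlet_form M (L2_0_adjoint M N T \<circ> J \<circ> T) f =
    ((L2_norm M f)\<^sup>2 - (L2_norm N (T f))\<^sup>2) + dirichlet_form N J (T f)"
  using L2_0_adjoint_spec(2)[OF assms(1-4) assms(6) assms(5)] by (simp add: dirichlet_form_def)

theorem theorem13:
  fixes \<pi> :: "'x measure" and Y :: "'y measure" and Z :: "'z measure"
    and \<pi>' :: "('y \<times> 'z) measure" and \<omega> :: "'z measure" and \<omega>z :: "'z \<Rightarrow> 'y measure"
    and S :: "'x \<Rightarrow> 'x measure" and Q :: "'y \<times> 'z \<Rightarrow> ('y \<times> 'z) measure"
    and Qz :: "'z \<Rightarrow> 'y \<Rightarrow> 'y measure"
    and P :: "('x \<Rightarrow> real) \<Rightarrow> 'y \<times> 'z \<Rightarrow> real"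
    and c0 \<kappa> :: real and f :: "'x \<Rightarrow> real"
  assumes "prob_space \<pi>"
    and "\<And>y. y \<in> space Y \<Longrightarrow> {y} \<in> sets Y"
    and "\<And>z. z \<in> space Z \<Longrightarrow> {z} \<in> sets Z"
    and "prob_space \<pi>'" and "sets \<pi>' = sets (Y \<Otimes>\<^sub>M Z)"
    and "\<omega> = distr \<pi>' Z snd"
    and "\<omega>z \<in> Z \<rightarrow>\<^sub>M prob_algebra Y"
    and "\<And>A. A \<in> sets (Y \<Otimes>\<^sub>M Z) \<Longrightarrow>
           emeasure \<pi>' A = (\<integral>\<^sup>+z. emeasure (\<omega>z z) {y. (y, z) \<in> A} \<partial>\<omega>)"
    and "reversible \<pi> S"
    and "L2_0_linear \<pi> \<pi>' P"
    and "reversible \<pi>' Q"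
    and "\<And>g. g \<in> L2_0 \<pi> \<Longrightarrow>
           AE x in \<pi>. kernel_op S g x = L2_0_adjoint \<pi> \<pi>' P (kernel_op Q (P g)) x"
    and "\<And>g. g \<in> L2_0 \<pi> \<Longrightarrow> L2_norm \<pi>' (P g) \<le> L2_norm \<pi> g"
    and "\<And>z. z \<in> space Z \<Longrightarrow> markov_kernel Y (Qz z)"
    and "AE z in \<omega>. reversible (\<omega>z z) (Qz z)"
    and "\<And>B. B \<in> sets Y \<Longrightarrow> (\<lambda>(y, z). measure (Qz z y) B) \<in> borel_measurable (Y \<Otimes>\<^sub>M Z)"
    and "0 < c0" and "c0 \<le> 1"
    and "AE (y, z) in \<pi>'. \<forall>B\<in>sets Y.
           measure (Q (y, z)) ((B - {y}) \<times> {z}) \<ge> c0 * measure (Qz z y) (B - {y})"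
    and "0 \<le> \<kappa>" and "\<kappa> \<le> 1"
    and "AE z in \<omega>. spectral_gap (\<omega>z z) (kernel_op (Qz z)) \<ge> ereal \<kappa>"
    and "f \<in> L2_0 \<pi>"
  shows "dirichlet_form \<pi> (kernel_op S) f
           \<ge> c0 * dirichlet_form \<pi> (L2_0_adjoint \<pi> \<pi>' P \<circ> kernel_op (fibre_kernel Z Qz) \<circ> P) f
       \<and> c0 * dirichlet_form \<pi> (L2_0_adjoint \<pi> \<pi>' P \<circ> kernel_op (fibre_kernel Z Qz) \<circ> P) f
           \<ge> c0 * \<kappa> * dirichlet_form \<pi> (L2_0_adjoint \<pi> \<pi>' P \<circ> fibre_lift \<circ> fibre_mean \<omega>z \<circ> P) f"
proof -
  interpret disintegration \<pi>' Y Z \<omega> \<omega>z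
    using assms(4-8) by (simp add: disintegration_def disintegration_axioms_def)
  have Qz_space: "prob_space (Qz z y)" "sets (Qz z y) = sets Y" if "y \<in> space Y" "z \<in> space Z" for y z
    using measurable_space[OF assms(14)[OF that(2), unfolded markov_kernel_def] that(1)]
    by (auto simp: space_prob_algebra)
  \<comment> \<open>Joint measurability is assumed for real-valued \<open>measure\<close>; as every
    \<open>Qz z y\<close> is finite, it carries over to \<open>emeasure\<close>, which generates the
    algebra of measures.\<close>
  have Qz_measurable: "(\<lambda>(y, z). Qz z y) \<in> Y \<Otimes>\<^sub>M Z \<rightarrow>\<^sub>M prob_algebra Y"
  proof (rule measurable_prob_algebraI[OF _ measurable_subprob_algebra])
    fix B assume B: "B \<in> sets Y"
    have "(\<lambda>w. ennreal (measure (Qz (snd w) (fst w)) B)) \<in> borel_measurable (Y \<Otimes>\<^sub>M Z)"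
      using assms(16)[OF B] by (simp add: case_prod_beta')
    also have "?this \<longleftrightarrow> (\<lambda>w. emeasure (case w of (y, z) \<Rightarrow> Qz z y) B) \<in> borel_measurable (Y \<Otimes>\<^sub>M Z)"
      using Qz_space
      by (intro measurable_cong)
        (auto simp: space_pair_measure finite_measure.emeasure_eq_measure prob_space.finite_measure)
    finally show "(\<lambda>w. emeasure (case w of (y, z) \<Rightarrow> Qz z y) B) \<in> borel_measurable (Y \<Otimes>\<^sub>M Z)" .
  qed (auto simp: space_pair_measure Qz_space prob_space_imp_subprob_space)
  interpret Qf: fibre_kernels \<pi>' Y Z \<omega> \<omega>z Qz
  proof
    show "AE z in \<omega>. \<omega>z z \<bind> Qz z = \<omega>z z"
      using assms(15) by eventually_elim (simp add: reversible_def)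
  qed (rule Qz_measurable)
  interpret mean: fibre_kernels \<pi>' Y Z \<omega> \<omega>z "\<lambda>z y. \<omega>z z" by (rule conditional_fibre_kernels)
  interpret Q: invariant_kernel \<pi>' Q using assms(4,11) by (rule reversible_invariant_kernel)
  interpret S: invariant_kernel \<pi> S using assms(1,9) by (rule reversible_invariant_kernel)
  interpret Qh: invariant_kernel \<pi>' "fibre_kernel Z Qz" by (rule Qf.invariant_fibre_kernel)
  interpret EE: invariant_kernel \<pi>' "fibre_kernel Z (\<lambda>z y. \<omega>z z)" by (rule mean.invariant_fibre_kernel)
  let ?Pa = "L2_0_adjoint \<pi> \<pi>' P"
  let ?M = "fibre_kernel Z (\<lambda>z y. \<omega>z z)"
  define h where "h = P f"
  have h: "h \<in> L2_0 \<pi>'" using assms(10,23) by (auto simp: h_def L2_0_linear_def)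
  \<comment> \<open>All three Dirichlet forms of the conclusion contain this same deficit.\<close>
  define D where "D = (L2_norm \<pi> f)\<^sup>2 - (L2_norm \<pi>' h)\<^sup>2"
  have D: "0 \<le> D"
    using assms(13)[OF assms(23)] by (simp add: D_def h_def power_mono L2_norm_def L2_inner_nonneg)
  have compression: "dirichlet_form \<pi> (?Pa \<circ> J \<circ> P) f = D + dirichlet_form \<pi>' J h"
    if "J h \<in> L2_0 \<pi>'" for J
    using dirichlet_form_compression[OF assms(1,4,10,13,23), of J] that by (simp add: D_def h_def)
  \<comment> \<open>The factorisation of \<open>S\<close> is an almost-everywhere identity, which is
    enough inside an inner product.\<close>
  have "L2_inner \<pi> f (kernel_op S f) = L2_inner \<pi> f (?Pa (kernel_op Q h))"
    using assms(12)[OF assms(23)] S.kernel_op_L2_0[OF assms(23)]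
      L2_0_adjoint_spec(1)[OF assms(1,4,10,13) Q.kernel_op_L2_0[OF h]] assms(23)
    unfolding h_def[symmetric] L2_inner_commute[of \<pi> f] by (rule L2_inner_cong_AE)
  then have "dirichlet_form \<pi> (kernel_op S) f = dirichlet_form \<pi> (?Pa \<circ> kernel_op Q \<circ> P) f"
    by (simp add: dirichlet_form_def h_def)
  then have eS: "dirichlet_form \<pi> (kernel_op S) f = D + dirichlet_form \<pi>' (kernel_op Q) h"
    using compression[of "kernel_op Q", OF Q.kernel_op_L2_0[OF h]] by simp
  have eQ: "dirichlet_form \<pi> (?Pa \<circ> kernel_op (fibre_kernel Z Qz) \<circ> P) f =
      D + dirichlet_form \<pi>' (kernel_op (fibre_kernel Z Qz)) h"
    by (rule compression[of "kernel_op (fibre_kernel Z Qz)", OF Qh.kernel_op_L2_0[OF h]])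
  have mean_eq: "kernel_op ?M h w = (fibre_lift \<circ> fibre_mean \<omega>z) h w" if "w \<in> space \<pi>'" for w
    using kernel_op_conditional[OF L2_0D(1)[OF h] that] by simp
  then have "L2_inner \<pi>' h ((fibre_lift \<circ> fibre_mean \<omega>z) h) = L2_inner \<pi>' h (kernel_op ?M h)"
    unfolding L2_inner_def by (intro Bochner_Integration.integral_cong) auto
  then have eM: "dirichlet_form \<pi> (?Pa \<circ> fibre_lift \<circ> fibre_mean \<omega>z \<circ> P) f =
      D + dirichlet_form \<pi>' (kernel_op ?M) h"
    using compression[of "fibre_lift \<circ> fibre_mean \<omega>z", OF L2_0_cong[OF mean_eq EE.kernel_op_L2_0[OF h]]]
    by (simp add: dirichlet_form_def comp_assoc)
  have 1: "c0 * dirichlet_form \<pi>' (kernel_op (fibre_kernel Z Qz)) h \<le> dirichlet_form \<pi>' (kernel_op Q) h"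
    using assms(17,19) L2_0D(1,2)[OF h]
    by (intro Qf.dirichlet_form_ge_fibre_kernel Q.invariant_kernel_axioms assms(2,3)) auto
  have 2: "\<kappa> * dirichlet_form \<pi>' (kernel_op ?M) h \<le> dirichlet_form \<pi>' (kernel_op (fibre_kernel Z Qz)) h"
    using L2_0D(1,2)[OF h] by (intro Qf.dirichlet_form_fibre_kernel_ge assms(22,20))
  \<comment> \<open>Here \<open>c0 \<le> 1\<close> and \<open>\<kappa> \<le> 1\<close> enter:
    scaling shrinks the nonnegative deficit, so it can be added to both comparisons. The second
    comparison is finally multiplied by \<open>c0\<close>.\<close>
  have "c0 * D \<le> D" "\<kappa> * D \<le> D"
    using D assms(17,18,20,21) by (simp_all add: mult_left_le_one_le)
  then have "c0 * (D + dirichlet_form \<pi>' (kernel_op (fibre_kernel Z Qz)) h) \<le> D + dirichlet_form \<pi>' (kernel_op Q) h"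
    and "\<kappa> * (D + dirichlet_form \<pi>' (kernel_op ?M) h) \<le> D + dirichlet_form \<pi>' (kernel_op (fibre_kernel Z Qz)) h"
    using 1 2 by (simp_all add: distrib_left)
  then show ?thesis
    unfolding eS eQ eM using assms(17) by (simp add: mult.assoc)
qed

end
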